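(* Let $\lambda>1$ be a natural number, let $\varepsilon>0$ be a real parameter, and let $(h,c)\in\Sigma^{p,-}\cup\Sigma^{p,+}$, where $$\Sigma^{p,-}:=\left\{(h,c)\in\mathbb{R}^2: h^2<\lambda^{\lambda}\left(\tfrac{2}{\lambda+1}\right)^{\lambda+1}c^{\lambda+1},\ h<0,\ c>0\right\},\quad \Sigma^{p,+}:=\left\{(h,c)\in\mathbb{R}^2: h^2<\lambda^{\lambda}\left(\tfrac{2}{\lambda+1}\right)^{\lambda+1}c^{\lambda+1},\ h>0,\ c>0\right\}.$$ Let $$V:=\mathbb{R}^3\setminus\left(\{(x,y,z): y=0\}\cup\{(M,-M\sqrt\lambda,0): M\in\mathbb{R}\}\cup\{(M,M\sqrt\lambda,0): M\in\mathbb{R}\}\cup\{(0,0,M): M\in\mathbb{R}\}\right).$$ Then the following perturbation of the rattleback system $\dot x=\lambda xz,\ \dot y=-yz,\ \dot z=y^2-\lambda x^2$, $$p:\quad \begin{bmatrix}\dot x\\ \dot y\\ \dot z\end{bmatrix}=\begin{bmatrix}\lambda xz\\ -yz\\ y^2-\lambda x^2\end{bmatrix}+\varepsilon\left(xy^{\lambda}-h\right)y^{\lambda-1}\begin{bmatrix} y(\lambda x^2-y^2-z^2)\\ x(-\lambda x^2+y^2-\lambda z^2)\\ (\lambda+1)xyz\end{bmatrix},\qquad (x,y,z)\in V,$$ asymptotically stabilizes with phase both periodic orbits of the rattleback system that constitute $\mathcal{EC}^{-1}(\{(h,c)\})$, with respect to perturbations in $V$ along the invariant manifold $C^{-1}(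\{c\})$.
   Context: Here $C(x,y,z)=\frac12(x^2+y^2+z^2)$ and $\mathcal{EC}:\mathbb{R}^3\to\mathbb{R}^2$, $\mathcal{EC}(x,y,z)=(xy^{\lambda},C(x,y,z))$. For $(h,c)\in\Sigma^{p,-}\cup\Sigma^{p,+}$ the fiber $\mathcal{EC}^{-1}(\{(h,c)\})$ is a pair of disjoint periodic orbits of the rattleback system. The function $C$ is a first integral of both the rattleback system and $p$. The system $p$ asymptotically stabilizes with phase a periodic orbit $\Gamma$ of the rattleback system, with respect to perturbations in $V$ along $C^{-1}(\{c\})$, if $\Gamma$ is a periodic orbit of $p$ and, for the dynamics of $p$ restricted to $V\cap C^{-1}(\{c\})$, it is orbitally asymptotically stable with phase: $\Gamma$ is orbitally stable, solutions starting sufficiently near $\Gamma$ satisfy $\operatorname{dist}(u(t),\Gamma)\to0$ as $t\to\infty$, and for each such solution $u$ there is a phase $\theta\in\mathbb{R}$ with $\|u(t)-\gamma(t+\theta)\|\to0$ as $t\to\infty$, where $\gamma$ is a periodic solution of $p$ parametrizing $\Gamma$. *)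

theory Defs
  imports "HOL-Analysis.Analysis"
begin

definition solution_on ::
  "('a::real_normed_vector \<Rightarrow> 'a) \<Rightarrow> 'a set \<Rightarrow> real set \<Rightarrow> (real \<Rightarrow> 'a) \<Rightarrow> bool" where
  "solution_on X D I u \<longleftrightarrow>
     (\<forall>t\<in>I. u t \<in> D \<and> (u has_vector_derivative X (u t)) (at t within I))"

text \<open>\<open>T\<close> need not be the minimal period; equilibria are not periodic orbits.\<close>

definition periodic_solution ::
  "('a::real_normed_vector \<Rightarrow> 'a) \<Rightarrow> 'a set \<Rightarrow> (real \<Rightarrow> 'a) \<Rightarrow> bool" where
  "periodic_solution X D \<gamma> \<longleftrightarrow>
     solution_on X D UNIV \<gamma> \<and> (\<exists>T>0. \<forall>t. \<gamma> (t + T) = \<gamma> t) \<and> (\<exists>t. \<gamma> t \<noteq> \<gamma> 0)"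

definition periodic_orbit ::
  "('a::real_normed_vector \<Rightarrow> 'a) \<Rightarrow> 'a set \<Rightarrow> 'a set \<Rightarrow> bool" where
  "periodic_orbit X D \<Gamma> \<longleftrightarrow> (\<exists>\<gamma>. periodic_solution X D \<gamma> \<and> \<Gamma> = range \<gamma>)"

text \<open>The first conjunct below says that solutions in \<open>S\<close> starting near \<open>\<Gamma>\<close> exist for all
  forward times, so that the quantification over solutions on \<open>{0..}\<close> covers every initial
  state near \<open>\<Gamma>\<close>.\<close>

definition orbitally_stable ::
  "('a::real_normed_vector \<Rightarrow> 'a) \<Rightarrow> 'a set \<Rightarrow> 'a set \<Rightarrow> bool" where
  "orbitally_stable X S \<Gamma> \<longleftrightarrow>
     (\<exists>\<delta>>0. \<forall>a\<in>S. infdist a \<Gamma> < \<delta> \<longrightarrow> (\<exists>u. solution_on X S {0..} u \<and> u 0 = a)) \<and>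
     (\<forall>\<epsilon>>0. \<exists>\<delta>>0. \<forall>u. solution_on X S {0..} u \<and> infdist (u 0) \<Gamma> < \<delta> \<longrightarrow>
        (\<forall>t\<ge>0. infdist (u t) \<Gamma> < \<epsilon>))"

definition orbitally_asymptotically_stable_with_phase ::
  "('a::real_normed_vector \<Rightarrow> 'a) \<Rightarrow> 'a set \<Rightarrow> 'a set \<Rightarrow> bool" where
  "orbitally_asymptotically_stable_with_phase X S \<Gamma> \<longleftrightarrow>
     (\<exists>\<gamma>. periodic_solution X S \<gamma> \<and> \<Gamma> = range \<gamma> \<and>
        orbitally_stable X S \<Gamma> \<and>
        (\<exists>\<delta>>0. \<forall>u. solution_on X S {0..} u \<and> infdist (u 0) \<Gamma> < \<delta> \<longrightarrow>
           ((\<lambda>t. infdist (u t) \<Gamma>) \<longlongrightarrow> 0) at_top \<and>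
           (\<exists>\<theta>. ((\<lambda>t. norm (u t - \<gamma> (t + \<theta>))) \<longlongrightarrow> 0) at_top)))"

text \<open>The field \<open>P\<close>, with domain \<open>V\<close>, asymptotically stabilizes with phase the periodic orbit
  \<open>\<Gamma>\<close> of \<open>X\<close>, with respect to perturbations in \<open>V\<close> along \<open>M\<close>.\<close>

definition asymptotically_stabilizes_with_phase ::
  "('a::real_normed_vector \<Rightarrow> 'a) \<Rightarrow> ('a \<Rightarrow> 'a) \<Rightarrow> 'a set \<Rightarrow> 'a set \<Rightarrow> 'a set \<Rightarrow> bool" where
  "asymptotically_stabilizes_with_phase X P V M \<Gamma> \<longleftrightarrow>
     periodic_orbit X UNIV \<Gamma> \<and> periodic_orbit P V \<Gamma> \<and>
     orbitally_asymptotically_stable_with_phase P (V \<inter> M) \<Gamma>"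

definition rattleback :: "nat \<Rightarrow> real^3 \<Rightarrow> real^3" where
  "rattleback lam v = (let x = v$1; y = v$2; z = v$3 in
     vector [real lam * x * z, - y * z, y^2 - real lam * x^2])"

definition perturbed_rattleback :: "nat \<Rightarrow> real \<Rightarrow> real \<Rightarrow> real^3 \<Rightarrow> real^3" where
  "perturbed_rattleback lam \<epsilon> h v = (let x = v$1; y = v$2; z = v$3 in
     rattleback lam v +
     (\<epsilon> * (x * y^lam - h) * y^(lam - 1)) *\<^sub>R
       vector [y * (real lam * x^2 - y^2 - z^2),
               x * (- real lam * x^2 + y^2 - real lam * z^2),
               (real lam + 1) * x * y * z])"

definition casimir :: "real^3 \<Rightarrow> real" where
  "casimir v = 1/2 * ((v$1)^2 + (v$2)^2 + (v$3)^2)"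

definition energy_casimir :: "nat \<Rightarrow> real^3 \<Rightarrow> real \<times> real" where
  "energy_casimir lam v = (v$1 * (v$2)^lam, casimir v)"

definition Sigma_p_minus :: "nat \<Rightarrow> (real \<times> real) set" where
  "Sigma_p_minus lam =
     {(h, c). h^2 < real lam^lam * (2 / (real lam + 1))^(lam + 1) * c^(lam + 1) \<and> h < 0 \<and> c > 0}"

definition Sigma_p_plus :: "nat \<Rightarrow> (real \<times> real) set" where
  "Sigma_p_plus lam =
     {(h, c). h^2 < real lam^lam * (2 / (real lam + 1))^(lam + 1) * c^(lam + 1) \<and> h > 0 \<and> c > 0}"

definition perturbation_domain :: "nat \<Rightarrow> (real^3) set" where
  "perturbation_domain lam = UNIV -
     ({v. v$2 = 0} \<union>
      {vector [M, - M * sqrt (real lam), 0] | M. True} \<union>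
      {vector [M, M * sqrt (real lam), 0] | M. True} \<union>
      {vector [0, 0, M] | M. True})"

end

theory Submission imports Defs begin

text \<open>
  Write \<open>x\<close>, \<open>y\<close>, \<open>z\<close> for the coordinates, let \<open>H = x * y ^ lam\<close> be the energy and \<open>w = y\<^sup>2 - lam * x\<^sup>2\<close>
  the tilt. The perturbation keeps the Casimir constant, and along its solutions

  \<open>H' = - \<epsilon> * (H - h) * y ^ (2 * (lam - 1)) * (w\<^sup>2 + z\<^sup>2 * (y\<^sup>2 + lam\<^sup>2 * x\<^sup>2))\<close>.

  On the sphere \<open>casimir = c\<close> the factor after \<open>H - h\<close> vanishes only for \<open>y = 0\<close> and at the four equilibria with
  \<open>z = w = 0\<close>, where \<open>\<bar>H\<bar>\<close> takes its maximum. The condition on \<open>(h, c)\<close> says that \<open>0 < \<bar>h\<bar>\<close> and that \<open>\<bar>h\<bar>\<close> lies below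
  this maximum. Hence a band of energies around \<open>h\<close>, intersected with a half space \<open>y > 0\<close> or \<open>y < 0\<close>, is a compact
  forward invariant collar on which \<open>H - h\<close> decays exponentially (\<open>forward_invariant\<close>,
  \<open>energy_gap_decays\<close>).

  The remaining motion is a rotation. On the sphere, \<open>x\<^sup>2\<close> and \<open>y\<^sup>2\<close> are polynomials in \<open>z\<close> and \<open>w\<close>, and the
  unperturbed equations are \<open>z' = w\<close> and \<open>w' = - 2 * z * (y\<^sup>2 + lam\<^sup>2 * x\<^sup>2)\<close>: in the plane of \<open>z\<close> and \<open>w\<close> every
  solution in the collar turns around the origin, with angular velocity bounded away from zero. Along each ray from
  the origin \<open>H\<^sup>2\<close> is strictly decreasing while \<open>x\<close> and \<open>y\<close> do not vanish
  (\<open>energy_along_ray\<close>), so a level curve of the energy meets each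
  ray at most once, and points of the collar on the same ray are close when their energies are
  (\<open>same_angle_comparison\<close>).

  Both conclusions follow from this. A rattleback solution on the level curve returns to its starting point
  after a full turn, so the half of the fibre in each half space is a single periodic orbit
  (\<open>cycle_periodic_parametrization\<close>), and on it the perturbation vanishes. The energy gap is a Lyapunov function for this
  orbit (\<open>cycle_orbitally_stable\<close>). Finally, a perturbed solution is compared with the point of the orbit on
  the same ray. That point moves along the orbit with a velocity, measured in time along the orbit, whose difference
  from \<open>1\<close> is bounded by a multiple of the exponentially decaying energy gap; the accumulated delay therefore
  converges, and its limit is the phase (\<open>asymptotic_phase\<close>).

  Solutions are obtained from a Picard iteration on the half line for Lipschitz fields
  (\<open>lipschitz_field_half_line_solution\<close>), applied to a truncation of the polynomial field.
\<close>

section \<open>Scalar calculus on the half line and the line\<close>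

lemma half_line_derivative_interior:
  fixes f :: "real \<Rightarrow> real"
  assumes "(f has_real_derivative d) (at t within {0..})" "0 < t"
  shows "(f has_real_derivative d) (at t)"
proof -
  have "t \<in> interior {0::real..}" using assms(2) by (simp add: interior_real_atLeast)
  then show ?thesis using assms(1) at_within_interior by metis
qed

lemma half_line_nonincreasing:
  fixes f f' :: "real \<Rightarrow> real"
  assumes der: "\<And>t. 0 \<le> t \<Longrightarrow> (f has_real_derivative f' t) (at t within {0..})"
    and "\<And>t. 0 \<le> t \<Longrightarrow> f' t \<le> 0" and "0 \<le> s" "s \<le> t"
  shows "f t \<le> f s"
proof (rule DERIV_nonpos_imp_decreasing_open[OF \<open>s \<le> t\<close>])
  fix x assume "s < x" "x < t"
  then have "0 < x" using \<open>0 \<le> s\<close> by linarith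
  then show "\<exists>y. (f has_real_derivative y) (at x) \<and> y \<le> 0"
    using half_line_derivative_interior[OF der[of x]] assms(2)[of x] by (intro exI[of _ "f' x"]) simp
next
  show "continuous_on {s..t} f"
    by (rule continuous_on_subset[OF DERIV_continuous_on[of "{0..}" f f']])
       (use der \<open>0 \<le> s\<close> in auto)
qed

text \<open>Multiplying by the integrating factor \<open>exp (- k * t)\<close> turns the bound into monotonicity. The sign of
  \<open>k\<close> is free: positive \<open>k\<close> gives uniqueness of solutions, negative \<open>k\<close> exponential decay.\<close>

lemma half_line_gronwall:
  fixes f f' :: "real \<Rightarrow> real"
  assumes der: "\<And>t. 0 \<le> t \<Longrightarrow> (f has_real_derivative f' t) (at t within {0..})"
    and bound: "\<And>t. 0 \<le> t \<Longrightarrow> f' t \<le> k * f t" and "0 \<le> t"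
  shows "f t \<le> f 0 * exp (k * t)"
proof -
  have "((\<lambda>t. f t * exp (- k * t)) has_real_derivative (f' t - k * f t) * exp (- k * t))
          (at t within {0..})" if "0 \<le> t" for t
    using that by (auto intro!: derivative_eq_intros der simp: algebra_simps)
  then have "f t * exp (- k * t) \<le> f 0 * exp (- k * 0)"
    by (rule half_line_nonincreasing) (use bound \<open>0 \<le> t\<close> in \<open>auto simp: mult_nonpos_nonneg\<close>)
  then show ?thesis by (simp add: exp_minus field_simps)
qed

text \<open>The speed bound is integrable, so the motion has finite length and converges.\<close>

lemma half_line_limit_of_summable_speed:
  fixes f f' :: "real \<Rightarrow> real"
  assumes der: "\<And>t. 0 \<le> t \<Longrightarrow> (f has_real_derivative f' t) (at t within {0..})"
    and bound: "\<And>t. 0 \<le> t \<Longrightarrow> \<bar>f' t\<bar> \<le> M * exp (- k * t)" and "0 < k"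
  shows "\<exists>l. (f \<longlongrightarrow> l) at_top"
proof -
  \<comment> \<open>\<open>e t\<close> bounds the length of the motion after time \<open>t\<close>\<close>
  define e where "e t = M / k * exp (- k * t)" for t
  have M: "0 \<le> M" using bound[of 0] by simp
  have e0: "(e \<longlongrightarrow> 0) at_top"
  proof -
    have "filterlim (\<lambda>t. - k * t) at_bot at_top"
      using \<open>0 < k\<close> by (intro filterlim_tendsto_neg_mult_at_bot[OF tendsto_const]) (auto intro: filterlim_ident)
    then have "((\<lambda>t. M / k * exp (- k * t)) \<longlongrightarrow> M / k * 0) at_top"
      by (intro tendsto_intros filterlim_compose[OF exp_at_bot])
    then show ?thesis by (simp add: e_def[abs_def])
  qed
  have e': "(e has_real_derivative - (M * exp (- k * t))) (at t within {0..})" for t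
    unfolding e_def using \<open>0 < k\<close> by (auto intro!: derivative_eq_intros)
  have dist: "\<bar>f t - f s\<bar> \<le> e s" if "0 \<le> s" "s \<le> t" for s t
  proof -
    have "f t + e t \<le> f s + e s"
    proof (rule half_line_nonincreasing[OF _ _ that])
      show "((\<lambda>t. f t + e t) has_real_derivative f' x + - (M * exp (- k * x))) (at x within {0..})"
        if "0 \<le> x" for x using that by (intro DERIV_add der e')
    qed (use bound in \<open>simp add: abs_le_iff\<close>)
    moreover have "- f t + e t \<le> - f s + e s"
    proof (rule half_line_nonincreasing[OF _ _ that])
      show "((\<lambda>t. - f t + e t) has_real_derivative - f' x + - (M * exp (- k * x))) (at x within {0..})"
        if "0 \<le> x" for x using that by (intro DERIV_add DERIV_minus der e')
    qed (use bound in \<open>simp add: abs_le_iff minus_le_iff\<close>)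
    moreover have "0 \<le> e t" unfolding e_def using M \<open>0 < k\<close> by simp
    ultimately show ?thesis by linarith
  qed
  have "convergent (\<lambda>n. f (real n))"
  proof (intro Cauchy_convergent metric_CauchyI)
    fix r :: real assume "0 < r"
    then have "\<forall>\<^sub>F t in at_top. e t < r / 2" using order_tendstoD(2)[OF e0, of "r / 2"] by simp
    then obtain T where T: "\<And>t. T \<le> t \<Longrightarrow> e t < r / 2" by (auto simp: eventually_at_top_linorder)
    define N where "N = nat \<lceil>max T 0\<rceil>"
    have N: "T \<le> real N" unfolding N_def by linarith
    have "dist (f (real m)) (f (real n)) < r" if "N \<le> m" "N \<le> n" for m n
    proof -
      have "\<bar>f m - f N\<bar> \<le> e N" "\<bar>f n - f N\<bar> \<le> e N" using dist that by auto
      then show ?thesis using T[OF N] unfolding dist_real_def by linarith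
    qed
    then show "\<exists>N. \<forall>m\<ge>N. \<forall>n\<ge>N. dist (f (real m)) (f (real n)) < r" by blast
  qed
  then obtain l where l: "(\<lambda>n. f (real n)) \<longlonglongrightarrow> l" by (auto simp: convergent_def)
  have near: "\<bar>f t - l\<bar> \<le> e t" if "0 \<le> t" for t
  proof -
    have "(\<lambda>n. \<bar>f (real n) - f t\<bar>) \<longlonglongrightarrow> \<bar>l - f t\<bar>" by (intro tendsto_intros l)
    moreover have "\<exists>N. \<forall>n\<ge>N. \<bar>f (real n) - f t\<bar> \<le> e t"
      using dist[OF that] by (intro exI[of _ "nat \<lceil>t\<rceil>"]) (auto simp: nat_le_iff ceiling_le_iff)
    ultimately have "\<bar>l - f t\<bar> \<le> e t" by (rule LIMSEQ_le_const2)
    then show ?thesis by linarith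
  qed
  have "((\<lambda>t. f t - l) \<longlongrightarrow> 0) at_top"
    by (rule Lim_null_comparison[OF _ e0]) (use near in \<open>auto intro!: eventually_at_top_linorderI[of 0]\<close>)
  then show ?thesis using LIM_zero_iff by blast
qed

lemma antiderivative_on_line:
  fixes f :: "real \<Rightarrow> real"
  assumes "continuous_on UNIV f"
  obtains F where "\<And>t. (F has_real_derivative f t) (at t)"
proof -
  define F where "F u = (LBINT y=ereal 0..ereal u. f y)" for u
  have "(F has_real_derivative f t) (at t)" for t
  proof -
    have "(F has_vector_derivative f t) (at t within {- \<bar>t\<bar> - 1..\<bar>t\<bar> + 1})"
      unfolding F_def
      by (rule interval_integral_FTC2) (auto intro: continuous_on_subset[OF assms])
    moreover have "t \<in> interior {- \<bar>t\<bar> - 1..\<bar>t\<bar> + 1}" by auto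
    ultimately show ?thesis
      by (metis at_within_interior has_real_derivative_iff_has_vector_derivative)
  qed
  then show thesis by (rule that)
qed

text \<open>A speed bounded away from zero forces unbounded growth in both directions, so the function is a
  bijection of the line. This inverts the angle of a periodic solution as a function of time.\<close>

lemma increasing_bijection_inverse:
  fixes \<alpha> g :: "real \<Rightarrow> real"
  assumes der: "\<And>t. (\<alpha> has_real_derivative g t) (at t)" and g: "\<And>t. m \<le> g t" and m: "0 < m"
  obtains \<beta> where "\<And>x. \<alpha> (\<beta> x) = x" "\<And>t. \<beta> (\<alpha> t) = t"
    "\<And>x. (\<beta> has_real_derivative inverse (g (\<beta> x))) (at x)"
proof -
  have growth: "m * (t - s) \<le> \<alpha> t - \<alpha> s" if "s \<le> t" for s t
  proof (cases "s = t")
    case False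
    then have "s < t" using that by simp
    from MVT2[OF this, of \<alpha> g] der obtain x where "\<alpha> t - \<alpha> s = (t - s) * g x" by blast
    then show ?thesis using g[of x] \<open>s < t\<close> by (simp add: mult.commute mult_left_mono)
  qed simp
  have inj: "s = t" if "\<alpha> s = \<alpha> t" for s t
  proof (cases s t rule: linorder_cases)
    case less
    then have "0 < m * (t - s)" using m by simp
    then show ?thesis using growth[of s t] less that by linarith
  next
    case greater
    then have "0 < m * (s - t)" using m by simp
    then show ?thesis using growth[of t s] greater that by linarith
  qed
  have cont: "continuous_on A \<alpha>" for A
    using der DERIV_isCont continuous_at_imp_continuous_on by blast
  have surj: "\<exists>t. \<alpha> t = x" for x
  proof -
    define d where "d = \<bar>x - \<alpha> 0\<bar> / m"
    have d: "0 \<le> d" "m * d = \<bar>x - \<alpha> 0\<bar>" using m by (simp_all add: d_def)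
    have "\<alpha> (- d) \<le> x" "x \<le> \<alpha> d" using growth[of "-d" 0] growth[of 0 d] d by auto
    then show ?thesis using IVT'[of \<alpha> "- d" x d] cont d by auto
  qed
  define \<beta> where "\<beta> = inv \<alpha>"
  have ab: "\<alpha> (\<beta> x) = x" for x unfolding \<beta>_def using surj by (metis surj_f_inv_f surj_def)
  have ba: "\<beta> (\<alpha> t) = t" for t using inj ab by blast
  have lip: "m * \<bar>\<beta> x - \<beta> y\<bar> \<le> \<bar>x - y\<bar>" for x y
    using growth[of "\<beta> x" "\<beta> y"] growth[of "\<beta> y" "\<beta> x"] ab
    by (cases "\<beta> x \<le> \<beta> y") auto
  have "continuous_on UNIV \<beta>"
  proof (rule lipschitz_on_continuous_on)
    show "(1 / m)-lipschitz_on UNIV \<beta>"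
      using lip m by (intro lipschitz_onI) (auto simp: dist_real_def field_simps)
  qed
  then have "isCont \<beta> x" for x by (simp add: continuous_on_eq_continuous_at)
  then have "(\<beta> has_real_derivative inverse (g (\<beta> x))) (at x)" for x
    using g[of "\<beta> x"] m ab
    by (intro DERIV_inverse_function[OF der, of \<beta> x "x - 1" "x + 1"]) auto
  with ab ba show thesis by (rule that)
qed

section \<open>Solutions of autonomous differential equations\<close>

lemma half_line_integral_derivative:
  fixes f :: "real \<Rightarrow> 'a::banach"
  assumes "continuous_on {0..} f" and "0 \<le> t"
  shows "((\<lambda>t. integral {0..t} f) has_vector_derivative f t) (at t within {0..})"
proof -
  have "((\<lambda>t. integral {0..t} f) has_vector_derivative f t) (at t within {0..t + 1})"
    by (rule integral_has_vector_derivative)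
       (use assms in \<open>auto intro: continuous_on_subset\<close>)
  moreover have "at t within {0..t + 1} = at t within {0..}"
    by (rule at_within_nhd[of t "{..<t + 1}"]) (use assms in auto)
  ultimately show ?thesis by simp
qed

text \<open>The weight absorbs exponential growth uniformly in time. This makes the Picard operator a
  contraction on the whole half line at once, with no patching of local solutions.\<close>

lemma weighted_integral_bound:
  fixes f :: "real \<Rightarrow> 'a::banach"
  assumes cont: "continuous_on {0..} f" and bound: "\<And>s. 0 \<le> s \<Longrightarrow> norm (f s) \<le> M * exp (K * s)"
    and "0 < K" "0 \<le> t"
  shows "exp (- K * t) * norm (integral {0..t} f) \<le> M / K"
proof -
  have M: "0 \<le> M" using order_trans[OF norm_ge_zero bound[of 0]] by simp
  have int: "((\<lambda>s. M * exp (K * s)) has_integral M / K * exp (K * t) - M / K * exp (K * 0)) {0..t}"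
  proof (rule fundamental_theorem_of_calculus[OF \<open>0 \<le> t\<close>])
    fix s
    have "((\<lambda>s. M / K * exp (K * s)) has_real_derivative M * exp (K * s)) (at s within {0..t})"
      using \<open>0 < K\<close> by (auto intro!: derivative_eq_intros)
    then show "((\<lambda>s. M / K * exp (K * s)) has_vector_derivative M * exp (K * s)) (at s within {0..t})"
      by (simp add: has_real_derivative_iff_has_vector_derivative)
  qed
  have "norm (integral {0..t} f) \<le> integral {0..t} (\<lambda>s. M * exp (K * s))"
  proof (rule integral_norm_bound_integral)
    show "f integrable_on {0..t}"
      by (intro integrable_continuous_real continuous_on_subset[OF cont]) auto
    show "(\<lambda>s. M * exp (K * s)) integrable_on {0..t}" using int by blast
  qed (use bound in simp)
  also have "\<dots> \<le> M / K * exp (K * t)"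
    unfolding integral_unique[OF int] using M \<open>0 < K\<close> by simp
  finally have "exp (- K * t) * norm (integral {0..t} f) \<le> exp (- K * t) * (M / K * exp (K * t))"
    by (intro mult_left_mono) auto
  also have "\<dots> = M / K" by (simp add: exp_minus)
  finally show ?thesis .
qed

text \<open>Picard iteration for \<open>v t = exp (- K * t) *\<^sub>R u t\<close> in the space of bounded continuous functions. With
  \<open>K\<close> twice the Lipschitz constant, the integral operator contracts distances by one half.
  Functions are extended to negative times by their value at \<open>0\<close>.\<close>

lemma lipschitz_field_half_line_solution:
  fixes F :: "'a::euclidean_space \<Rightarrow> 'a"
  assumes lip: "\<And>u v. norm (F u - F v) \<le> L * norm (u - v)" and L: "0 < L"
  shows "\<exists>u. solution_on F UNIV {0..} u \<and> u 0 = a"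
proof -
  define K where "K = 2 * L"
  have K: "0 < K" using L by (simp add: K_def)
  have contF: "continuous_on S F" for S
  proof (rule continuous_on_subset)
    have "L-lipschitz_on UNIV F" using lip L by (intro lipschitz_onI) (auto simp: dist_norm)
    then show "continuous_on UNIV F" by (rule lipschitz_on_continuous_on)
  qed simp
  define f where "f v s = F (exp (K * s) *\<^sub>R apply_bcontfun v s)" for v :: "real \<Rightarrow>\<^sub>C 'a" and s
  have contf: "continuous_on S (f v)" for v S
    unfolding f_def by (intro continuous_on_compose2[OF contF[of UNIV]] continuous_intros) auto
  define J where "J v t = a + integral {0..t} (f v)" for v t
  have Jder: "(J v has_vector_derivative f v t) (at t within {0..})" if "0 \<le> t" for v t
  proof -
    have "(J v has_vector_derivative 0 + f v t) (at t within {0..})"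
      unfolding J_def
      by (intro has_vector_derivative_add has_vector_derivative_const half_line_integral_derivative contf that)
    then show ?thesis by simp
  qed
  have contJ: "continuous_on {0..} (J v)" for v
    unfolding continuous_on_eq_continuous_within
    using Jder has_vector_derivative_continuous by fastforce
  define G where "G v t = exp (- K * max 0 t) *\<^sub>R J v (max 0 t)" for v t
  have G_in: "G v \<in> bcontfun" for v
  proof (rule bcontfun_normI)
    show "continuous_on UNIV (G v)"
      unfolding G_def by (intro continuous_intros continuous_on_compose2[OF contJ]) auto
    define M where "M = norm (F 0) + L * norm v"
    have "norm (f v s) \<le> M * exp (K * s)" if "0 \<le> s" for s
    proof -
      have "norm (f v s) \<le> norm (F 0) + L * norm (exp (K * s) *\<^sub>R apply_bcontfun v s)"
        using lip[of "exp (K * s) *\<^sub>R apply_bcontfun v s" 0] norm_triangle_sub[of "f v s" "F 0"]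
        by (simp add: f_def)
      also have "L * norm (exp (K * s) *\<^sub>R apply_bcontfun v s) \<le> L * (exp (K * s) * norm v)"
        using L norm_bounded[of v s] by (simp add: mult_left_mono)
      also have "norm (F 0) \<le> norm (F 0) * exp (K * s)"
        using that K by (simp add: mult_le_cancel_left1)
      finally show ?thesis by (simp add: M_def algebra_simps)
    qed
    then have bd: "exp (- K * t) * norm (integral {0..t} (f v)) \<le> M / K" if "0 \<le> t" for t
      using that by (intro weighted_integral_bound contf K) auto
    show "norm (G v t) \<le> norm a + M / K" for t
    proof -
      define \<tau> where "\<tau> = max 0 t"
      have "norm (G v t) \<le> exp (- K * \<tau>) * (norm a + norm (integral {0..\<tau>} (f v)))"
        unfolding G_def J_def \<tau>_def by (simp add: mult_left_mono norm_triangle_ineq)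
      also have "\<dots> \<le> norm a + M / K"
        using bd[of \<tau>] K mult_right_mono[of "exp (- K * \<tau>)" 1 "norm a"]
        by (simp add: \<tau>_def distrib_left)
      finally show ?thesis .
    qed
  qed
  define \<Phi> where "\<Phi> v = Bcontfun (G v)" for v
  have app: "apply_bcontfun (\<Phi> v) = G v" for v
    unfolding \<Phi>_def using G_in by (simp add: Bcontfun_inverse)
  have "dist (\<Phi> v) (\<Phi> w) \<le> 1 / 2 * dist v w" for v w
  proof (rule dist_bound)
    fix t :: real
    define \<tau> where "\<tau> = max 0 t"
    have "norm (f v s - f w s) \<le> L * dist v w * exp (K * s)" for s
    proof -
      have "norm (f v s - f w s) \<le> L * (exp (K * s) * dist (apply_bcontfun v s) (apply_bcontfun w s))"
        using lip[of "exp (K * s) *\<^sub>R apply_bcontfun v s" "exp (K * s) *\<^sub>R apply_bcontfun w s"]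
        by (simp add: f_def dist_norm scaleR_diff_right[symmetric])
      also have "\<dots> \<le> L * (exp (K * s) * dist v w)"
        using L dist_bounded[of v s w] by (simp add: mult_left_mono)
      finally show ?thesis by (simp add: algebra_simps)
    qed
    then have "exp (- K * \<tau>) * norm (integral {0..\<tau>} (\<lambda>s. f v s - f w s)) \<le> L * dist v w / K"
      by (intro weighted_integral_bound continuous_intros contf K) (auto simp: \<tau>_def)
    moreover have "integral {0..\<tau>} (\<lambda>s. f v s - f w s) = integral {0..\<tau>} (f v) - integral {0..\<tau>} (f w)"
      by (intro integral_diff integrable_continuous_real contf)
    then have "G v t - G w t = exp (- K * \<tau>) *\<^sub>R integral {0..\<tau>} (\<lambda>s. f v s - f w s)"
      unfolding G_def J_def \<tau>_def by (simp add: scaleR_diff_right scaleR_add_right)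
    ultimately show "dist (apply_bcontfun (\<Phi> v) t) (apply_bcontfun (\<Phi> w) t) \<le> 1 / 2 * dist v w"
      using L by (simp add: app dist_norm K_def)
  qed
  then obtain v where v: "\<Phi> v = v" using banach_fix_type[of "1/2" \<Phi>] by auto
  have vt: "apply_bcontfun v t = exp (- K * t) *\<^sub>R J v t" if "0 \<le> t" for t
    using app[of v] that by (simp add: v G_def)
  have "(J v has_vector_derivative F (J v t)) (at t within {0..})" if "0 \<le> t" for t
    using Jder[OF that, of v] by (simp add: f_def vt[OF that] exp_minus)
  moreover have "J v 0 = a" by (simp add: J_def)
  ultimately show ?thesis unfolding solution_on_def by auto
qed

text \<open>The squared distance of two solutions grows at most exponentially and starts at zero.\<close>

lemma lipschitz_field_solutions_agree:
  fixes X :: "'a::real_inner \<Rightarrow> 'a"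
  assumes lip: "\<And>p q. p \<in> S \<Longrightarrow> q \<in> S \<Longrightarrow> norm (X p - X q) \<le> L * norm (p - q)"
    and u: "solution_on X S {0..} u" and v: "solution_on X S {0..} v" and "u 0 = v 0" "0 \<le> t"
  shows "u t = v t"
proof -
  define E where "E t = (u t - v t) \<bullet> (u t - v t)" for t
  have "(E has_real_derivative 2 * ((u t - v t) \<bullet> (X (u t) - X (v t)))) (at t within {0..})" if "0 \<le> t" for t
  proof -
    have "((\<lambda>t. u t - v t) has_vector_derivative X (u t) - X (v t)) (at t within {0..})"
      using u v that by (intro has_vector_derivative_diff) (auto simp: solution_on_def)
    from bounded_bilinear.has_vector_derivative[OF bounded_bilinear_inner this this]
    show ?thesis
      by (simp add: E_def[abs_def] has_real_derivative_iff_has_vector_derivative inner_commute)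
  qed
  moreover have "2 * ((u t - v t) \<bullet> (X (u t) - X (v t))) \<le> (2 * L) * E t" if "0 \<le> t" for t
  proof -
    have "u t \<in> S" "v t \<in> S" using u v that by (auto simp: solution_on_def)
    then have "(u t - v t) \<bullet> (X (u t) - X (v t)) \<le> norm (u t - v t) * (L * norm (u t - v t))"
      by (intro order_trans[OF norm_cauchy_schwarz] mult_left_mono lip norm_ge_zero)
    then show ?thesis by (simp add: E_def dot_square_norm power2_eq_square mult.left_commute)
  qed
  ultimately have "E t \<le> E 0 * exp ((2 * L) * t)"
    using \<open>0 \<le> t\<close> by (rule half_line_gronwall)
  then show ?thesis using \<open>u 0 = v 0\<close> using inner_gt_zero_iff[of "u t - v t"] by (simp add: E_def del: inner_gt_zero_iff)
qed

lemma solution_continuous_on: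
  assumes "solution_on X S I u"
  shows "continuous_on I u"
  using assms has_vector_derivative_continuous
  unfolding solution_on_def continuous_on_eq_continuous_within by blast

lemma solution_component_derivative:
  fixes u :: "real \<Rightarrow> real^'n"
  assumes "solution_on X S I u" "t \<in> I"
  shows "((\<lambda>t. u t $ i) has_real_derivative X (u t) $ i) (at t within I)"
proof -
  have "(u has_vector_derivative X (u t)) (at t within I)"
    using assms by (simp add: solution_on_def)
  from bounded_linear.has_vector_derivative[OF bounded_linear_vec_nth this]
  show ?thesis by (simp add: has_real_derivative_iff_has_vector_derivative)
qed

lemma solution_on_shift:
  assumes u: "solution_on X S {0..} u" and "0 \<le> T"
  shows "solution_on X S {0..} (\<lambda>t. u (t + T))"
  unfolding solution_on_def
proof (intro ballI conjI)
  fix t :: real assume t: "t \<in> {0..}"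
  then show "u (t + T) \<in> S" using u \<open>0 \<le> T\<close> by (auto simp: solution_on_def)
  have "((\<lambda>t. t + T) has_vector_derivative 1) (at t within {0..})"
    by (auto intro!: derivative_eq_intros)
  moreover have "(u has_vector_derivative X (u (t + T))) (at (t + T) within (\<lambda>t. t + T) ` {0..})"
    by (rule has_vector_derivative_within_subset[of _ _ _ "{0..}"])
       (use u t \<open>0 \<le> T\<close> in \<open>auto simp: solution_on_def\<close>)
  ultimately have "(u \<circ> (\<lambda>t. t + T) has_vector_derivative 1 *\<^sub>R X (u (t + T))) (at t within {0..})"
    by (rule vector_diff_chain_within)
  then show "((\<lambda>t. u (t + T)) has_vector_derivative X (u (t + T))) (at t within {0..})"
    by (simp add: comp_def)
qed

text \<open>Each negative time is moved into the half line by a sufficient number of periods; periodicity makes the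
  value independent of that number, so near every time the extension is a shift of the given
  solution.\<close>

lemma periodic_extension:
  assumes u: "solution_on X S {0..} u" and T: "0 < T" and per: "\<And>t. 0 \<le> t \<Longrightarrow> u (t + T) = u t"
  shows "\<exists>\<gamma>. solution_on X S UNIV \<gamma> \<and> (\<forall>t. \<gamma> (t + T) = \<gamma> t) \<and> range \<gamma> = u ` {0..}"
proof -
  have turns: "u (t + real n * T) = u t" if "0 \<le> t" for t n
  proof (induction n)
    case (Suc n)
    have "u ((t + real n * T) + T) = u (t + real n * T)" using that T by (intro per) simp
    then show ?case using Suc by (simp add: algebra_simps)
  qed simp
  have agree: "u (t + real m * T) = u (t + real n * T)" if "0 \<le> t + real m * T" "0 \<le> t + real n * T" for t m n
  proof (cases "m \<le> n")
    case True
    then show ?thesis using turns[OF that(1), of "n - m"] by (simp add: of_nat_diff algebra_simps)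
  next
    case False
    then show ?thesis using turns[OF that(2), of "m - n"] by (simp add: of_nat_diff algebra_simps)
  qed
  define N where "N t = nat \<lceil>\<bar>t\<bar> / T\<rceil> + 1" for t
  have N: "0 < t + real (N t) * T" for t
  proof -
    have "\<bar>t\<bar> / T < real (N t)" unfolding N_def by linarith
    then show ?thesis using T by (simp add: field_simps)
  qed
  define \<gamma> where "\<gamma> t = u (t + real (N t) * T)" for t
  have \<gamma>: "\<gamma> t = u (t + real n * T)" if "0 \<le> t + real n * T" for t n
    unfolding \<gamma>_def using N[of t] that by (intro agree) auto
  have "(\<gamma> has_vector_derivative X (\<gamma> t)) (at t)" for t
  proof (rule has_vector_derivative_transform_within_open)
    show "open {s. 0 < s + real (N t) * T}"
      by (intro open_Collect_less continuous_intros)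
    show "t \<in> {s. 0 < s + real (N t) * T}" using N by simp
    show "u (s + real (N t) * T) = \<gamma> s" if "s \<in> {s. 0 < s + real (N t) * T}" for s
      using \<gamma>[of s "N t"] that by simp
    have "t + real (N t) * T \<in> interior {0..}" using N[of t] by (simp add: interior_real_atLeast)
    then have "(u has_vector_derivative X (\<gamma> t)) (at (t + real (N t) * T))"
      using u N[of t] at_within_interior unfolding solution_on_def \<gamma>_def
      by (metis atLeast_iff less_imp_le)
    moreover have "((\<lambda>s. s + real (N t) * T) has_vector_derivative 1) (at t)"
      by (auto intro!: derivative_eq_intros)
    ultimately have "(u \<circ> (\<lambda>s. s + real (N t) * T) has_vector_derivative 1 *\<^sub>R X (\<gamma> t)) (at t)"
      by (intro vector_diff_chain_at)
    then show "((\<lambda>s. u (s + real (N t) * T)) has_vector_derivative X (\<gamma> t)) (at t)"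
      by (simp add: comp_def)
  qed
  moreover have in_orbit: "\<gamma> t \<in> u ` {0..}" for t unfolding \<gamma>_def using N[of t] by auto
  then have "\<gamma> t \<in> S" for t using u unfolding solution_on_def by (metis imageE)
  ultimately have sol: "solution_on X S UNIV \<gamma>" by (simp add: solution_on_def)
  have ext: "\<gamma> t = u t" if "0 \<le> t" for t using \<gamma>[of t 0] that by simp
  have "\<gamma> (t + T) = \<gamma> t" for t
    using \<gamma>[of t "N (t + T) + 1"] N[of "t + T"] by (simp add: \<gamma>_def algebra_simps)
  moreover have "range \<gamma> = u ` {0..}"
  proof (intro subset_antisym subsetI)
    fix p assume "p \<in> u ` {0..}"
    then obtain t where "0 \<le> t" "p = u t" by auto
    then show "p \<in> range \<gamma>" using ext[of t] by (metis rangeI)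
  qed (use in_orbit in auto)
  ultimately show ?thesis using sol by blast
qed

section \<open>Polar angle along a plane curve\<close>

text \<open>If the angular velocity of a plane curve is \<open>g\<close>, then any antiderivative \<open>\<alpha>\<close> of \<open>g\<close> with the right initial
  value is a polar angle: the unit vector \<open>(z, w) / r\<close> and \<open>(sin \<alpha>, cos \<alpha>)\<close> solve the same linear
  equation. The angle is measured from the \<open>w\<close> axis towards the \<open>z\<close> axis, the direction
  in which the rattleback turns.\<close>

lemma polar_angle_transported:
  fixes z w z' w' \<alpha> g :: "real \<Rightarrow> real"
  assumes I: "convex I" "t0 \<in> I" "t \<in> I"
    and z: "\<And>t. t \<in> I \<Longrightarrow> (z has_real_derivative z' t) (at t within I)"
    and w: "\<And>t. t \<in> I \<Longrightarrow> (w has_real_derivative w' t) (at t within I)"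
    and \<alpha>: "\<And>t. t \<in> I \<Longrightarrow> (\<alpha> has_real_derivative g t) (at t within I)"
    and pos: "\<And>t. t \<in> I \<Longrightarrow> 0 < (z t)\<^sup>2 + (w t)\<^sup>2"
    and g: "\<And>t. t \<in> I \<Longrightarrow> w t * z' t - z t * w' t = g t * ((z t)\<^sup>2 + (w t)\<^sup>2)"
    and init: "z t0 = sqrt ((z t0)\<^sup>2 + (w t0)\<^sup>2) * sin (\<alpha> t0)"
      "w t0 = sqrt ((z t0)\<^sup>2 + (w t0)\<^sup>2) * cos (\<alpha> t0)"
  shows "z t = sqrt ((z t)\<^sup>2 + (w t)\<^sup>2) * sin (\<alpha> t) \<and> w t = sqrt ((z t)\<^sup>2 + (w t)\<^sup>2) * cos (\<alpha> t)"
proof -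
  define r where "r t = sqrt ((z t)\<^sup>2 + (w t)\<^sup>2)" for t
  define p where "p t = z t / r t" for t
  define q where "q t = w t / r t" for t
  have r0: "0 < r t" and r2: "r t * r t = (z t)\<^sup>2 + (w t)\<^sup>2" if "t \<in> I" for t
    using pos[OF that] by (auto simp: r_def)
  have r': "(r has_real_derivative (z t * z' t + w t * w' t) / r t) (at t within I)" if "t \<in> I" for t
  proof -
    have "((\<lambda>t. (z t)\<^sup>2 + (w t)\<^sup>2) has_real_derivative 2 * (z t * z' t + w t * w' t)) (at t within I)"
      using that by (auto intro!: derivative_eq_intros z w)
    from DERIV_chain2[OF DERIV_real_sqrt[OF pos[OF that]] this]
    have "(r has_real_derivative inverse (r t) / 2 * (2 * (z t * z' t + w t * w' t))) (at t within I)"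
      unfolding r_def[abs_def] .
    moreover have "inverse (r t) / 2 * (2 * x) = x / r t" for x
      by (simp add: field_simps)
    ultimately show ?thesis by (simp only:)
  qed
  have p': "(p has_real_derivative g t * q t) (at t within I)"
    and q': "(q has_real_derivative - g t * p t) (at t within I)" if t: "t \<in> I" for t
  proof -
    define S where "S = z t * z' t + w t * w' t"
    have quotient: "(a * r t - b * (S / r t)) / (r t * r t) = k" if "a * (r t * r t) - b * S = k * r t * (r t * r t)" for a b k
    proof -
      have "(a * r t - b * (S / r t)) * r t = (k * (r t * r t)) * r t"
        using that r0[OF t] by (simp add: algebra_simps)
      then have "a * r t - b * (S / r t) = k * (r t * r t)" using r0[OF t] by simp
      then show ?thesis using r0[OF t] by (simp add: nonzero_divide_eq_eq)
    qed
    have "z' t * (r t * r t) - z t * S = w t * (w t * z' t - z t * w' t)"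
      unfolding r2[OF t] S_def by (simp add: algebra_simps power2_eq_square)
    also have "\<dots> = g t * w t * (r t * r t)" unfolding g[OF t] r2[OF t] by simp
    also have "\<dots> = g t * q t * r t * (r t * r t)" using r0[OF t] by (simp add: q_def)
    finally have 1: "(z' t * r t - z t * (S / r t)) / (r t * r t) = g t * q t" by (rule quotient)
    have "w' t * (r t * r t) - w t * S = - (z t * (w t * z' t - z t * w' t))"
      unfolding r2[OF t] S_def by (simp add: algebra_simps power2_eq_square)
    also have "\<dots> = - g t * z t * (r t * r t)" unfolding g[OF t] r2[OF t] by simp
    also have "\<dots> = - g t * p t * r t * (r t * r t)" using r0[OF t] by (simp add: p_def)
    finally have 2: "(w' t * r t - w t * (S / r t)) / (r t * r t) = - g t * p t" by (rule quotient)
    have rt: "r t \<noteq> 0" using r0[OF t] by simp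
    show "(p has_real_derivative g t * q t) (at t within I)"
      using DERIV_divide[OF z[OF t] r'[OF t] rt] unfolding p_def[abs_def] S_def[symmetric] 1 .
    show "(q has_real_derivative - g t * p t) (at t within I)"
      using DERIV_divide[OF w[OF t] r'[OF t] rt] unfolding q_def[abs_def] S_def[symmetric] 2 .
  qed
  define A where "A t = p t * cos (\<alpha> t) - q t * sin (\<alpha> t)" for t
  define B where "B t = p t * sin (\<alpha> t) + q t * cos (\<alpha> t)" for t
  have "(A has_real_derivative 0) (at t within I)" "(B has_real_derivative 0) (at t within I)"
    if "t \<in> I" for t
    unfolding A_def[abs_def] B_def[abs_def]
    using that by (auto intro!: derivative_eq_intros p' q' \<alpha> simp: algebra_simps)
  then have AB: "A t = A t0" "B t = B t0"
    using has_field_derivative_zero_constant[OF I(1), of A]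
      has_field_derivative_zero_constant[OF I(1), of B] I by metis+
  have sc: "sin x * sin x + cos x * cos x = 1" for x :: real
    using sin_cos_squared_add[of x] by (simp add: power2_eq_square)
  have "z t0 = r t0 * sin (\<alpha> t0)" "w t0 = r t0 * cos (\<alpha> t0)"
    using init unfolding r_def .
  then have "p t0 = sin (\<alpha> t0)" "q t0 = cos (\<alpha> t0)"
    using r0[OF \<open>t0 \<in> I\<close>] by (simp_all add: p_def q_def)
  then have "A t0 = 0" "B t0 = 1" by (simp_all add: A_def B_def sc)
  then have A: "p t * cos (\<alpha> t) - q t * sin (\<alpha> t) = 0"
    and B: "p t * sin (\<alpha> t) + q t * cos (\<alpha> t) = 1"
    using AB by (simp_all add: A_def B_def)
  have "p t = sin (\<alpha> t)" "q t = cos (\<alpha> t)"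
    using A B sc[of "\<alpha> t"] by algebra+
  then show ?thesis using r0[OF \<open>t \<in> I\<close>] unfolding r_def[symmetric] by (simp add: p_def q_def field_simps)
qed

lemma polar_angle_exists:
  fixes z w :: real
  obtains a where "z = sqrt (z\<^sup>2 + w\<^sup>2) * sin a" "w = sqrt (z\<^sup>2 + w\<^sup>2) * cos a"
proof (cases "z\<^sup>2 + w\<^sup>2 = 0")
  case True
  then show thesis using that[of 0] by simp
next
  case False
  define r where "r = sqrt (z\<^sup>2 + w\<^sup>2)"
  have "(w / r)\<^sup>2 + (z / r)\<^sup>2 = 1"
    using False by (simp add: r_def power_divide add_divide_distrib[symmetric] add.commute)
  from sincos_total_2pi[OF this] obtain a where "w / r = cos a" "z / r = sin a" by metis
  moreover have "r \<noteq> 0" using False by (simp add: r_def)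
  ultimately have "z = r * sin a" "w = r * cos a" by (simp_all add: field_simps)
  then show thesis using that[of a] unfolding r_def by blast
qed

section \<open>The perturbed rattleback, its Casimir and its energy\<close>

definition energy :: "nat \<Rightarrow> real^3 \<Rightarrow> real" where
  "energy lam v = v$1 * (v$2) ^ lam"

text \<open>The third component of the rattleback field: the velocity of the height \<open>z\<close>.\<close>

definition tilt :: "nat \<Rightarrow> real^3 \<Rightarrow> real" where
  "tilt lam v = (v$2)\<^sup>2 - real lam * (v$1)\<^sup>2"

text \<open>Along the rattleback the tilt changes at the rate \<open>- 2 * z * stiffness\<close>, so height and tilt
  together behave like an oscillator with this variable spring constant.\<close>

definition stiffness :: "nat \<Rightarrow> real^3 \<Rightarrow> real" where
  "stiffness lam v = (v$2)\<^sup>2 + (real lam)\<^sup>2 * (v$1)\<^sup>2"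

text \<open>The relative rate, per unit of \<open>\<epsilon>\<close>, at which the perturbation drives the energy towards \<open>h\<close>. For \<open>lam > 1\<close> it
  vanishes only for \<open>y = 0\<close> and where height and tilt are both zero; these are points that the
  domain of the perturbed system omits.\<close>

definition dissipation :: "nat \<Rightarrow> real^3 \<Rightarrow> real" where
  "dissipation lam v =
     ((v$2) ^ (lam - 1))\<^sup>2 * ((tilt lam v)\<^sup>2 + (v$3)\<^sup>2 * stiffness lam v)"

lemma perturbed_rattleback_components:
  fixes v :: "real^3" and lam and \<epsilon> h :: real
  defines "s \<equiv> \<epsilon> * (energy lam v - h) * (v$2) ^ (lam - 1)"
  shows "perturbed_rattleback lam \<epsilon> h v $ 1 =
      real lam * v$1 * v$3 + s * (v$2 * (real lam * (v$1)\<^sup>2 - (v$2)\<^sup>2 - (v$3)\<^sup>2))"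
    and "perturbed_rattleback lam \<epsilon> h v $ 2 =
      - v$2 * v$3 + s * (v$1 * (- real lam * (v$1)\<^sup>2 + (v$2)\<^sup>2 - real lam * (v$3)\<^sup>2))"
    and "perturbed_rattleback lam \<epsilon> h v $ 3 =
      (v$2)\<^sup>2 - real lam * (v$1)\<^sup>2 + s * ((real lam + 1) * v$1 * v$2 * v$3)"
  unfolding s_def energy_def perturbed_rattleback_def rattleback_def
  by (simp_all add: Let_def)

lemma perturbed_rattleback_eq_rattleback:
  "\<epsilon> * (energy lam v - h) = 0 \<Longrightarrow> perturbed_rattleback lam \<epsilon> h v = rattleback lam v"
  by (simp add: perturbed_rattleback_def energy_def Let_def)

lemma casimir_eq_norm: "casimir v = (norm v)\<^sup>2 / 2"
  by (simp add: casimir_def norm_vec_def L2_set_def sum_3)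

lemma perturbed_rattleback_tangent: "v \<bullet> perturbed_rattleback lam \<epsilon> h v = 0"
  unfolding inner_vec_def sum_3 perturbed_rattleback_components inner_real_def by algebra

text \<open>The perturbation is tangent to the Casimir spheres, and its effect on the energy is minus a
  multiple of \<open>energy - h\<close> by a nonnegative function. The equations for height and tilt
  are closed once the Casimir and the energy are known, which is what reduces the dynamics to a plane.\<close>

context
  fixes lam :: nat and \<epsilon> h :: real and S I u and t :: real
  assumes lam: "0 < lam"
    and sol: "solution_on (perturbed_rattleback lam \<epsilon> h) S I u" and t: "t \<in> I"
begin

private lemmas comp = solution_component_derivative[OF sol t]

lemma casimir_derivative: "((\<lambda>t. casimir (u t)) has_real_derivative 0) (at t within I)"
proof -
  have "((\<lambda>t. casimir (u t)) has_real_derivative u t \<bullet> perturbed_rattleback lam \<epsilon> h (u t)) (at t within I)"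
    unfolding casimir_def inner_vec_def sum_3 by (auto intro!: derivative_eq_intros comp)
  then show ?thesis by (simp add: perturbed_rattleback_tangent)
qed

lemma energy_derivative:
  "((\<lambda>t. energy lam (u t)) has_real_derivative
     - \<epsilon> * (energy lam (u t) - h) * dissipation lam (u t)) (at t within I)"
proof -
  have pow: "u t $ 2 ^ lam = u t $ 2 * u t $ 2 ^ (lam - 1)" using lam by (cases lam) auto
  have "((\<lambda>t. energy lam (u t)) has_real_derivative
      perturbed_rattleback lam \<epsilon> h (u t) $ 1 * (u t $ 2) ^ lam
      + (real lam * (u t $ 2) ^ (lam - 1) * perturbed_rattleback lam \<epsilon> h (u t) $ 2) * u t $ 1) (at t within I)"
    unfolding energy_def by (auto intro!: derivative_eq_intros comp)
  moreover have "perturbed_rattleback lam \<epsilon> h (u t) $ 1 * (u t $ 2) ^ lam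
      + (real lam * (u t $ 2) ^ (lam - 1) * perturbed_rattleback lam \<epsilon> h (u t) $ 2) * u t $ 1
      = - \<epsilon> * (energy lam (u t) - h) * dissipation lam (u t)"
    unfolding perturbed_rattleback_components dissipation_def tilt_def stiffness_def pow
    by algebra
  ultimately show ?thesis by simp
qed

lemma height_derivative:
  "((\<lambda>t. u t $ 3) has_real_derivative
     tilt lam (u t) + (real lam + 1) * \<epsilon> * (energy lam (u t) - h) * energy lam (u t) * u t $ 3) (at t within I)"
proof -
  have pow: "u t $ 2 ^ lam = u t $ 2 * u t $ 2 ^ (lam - 1)" using lam by (cases lam) auto
  have "perturbed_rattleback lam \<epsilon> h (u t) $ 3
      = tilt lam (u t) + (real lam + 1) * \<epsilon> * (energy lam (u t) - h) * energy lam (u t) * u t $ 3"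
    unfolding perturbed_rattleback_components tilt_def energy_def pow by algebra
  then show ?thesis using comp[of 3] by simp
qed

lemma tilt_derivative:
  "((\<lambda>t. tilt lam (u t)) has_real_derivative
     - 2 * u t $ 3 * stiffness lam (u t)
     + 2 * (real lam + 1) * \<epsilon> * (energy lam (u t) - h) * energy lam (u t) * tilt lam (u t)) (at t within I)"
proof -
  have pow: "u t $ 2 ^ lam = u t $ 2 * u t $ 2 ^ (lam - 1)" using lam by (cases lam) auto
  have "((\<lambda>t. tilt lam (u t)) has_real_derivative
      2 * u t $ 2 * perturbed_rattleback lam \<epsilon> h (u t) $ 2
      - real lam * (2 * u t $ 1 * perturbed_rattleback lam \<epsilon> h (u t) $ 1)) (at t within I)"
    unfolding tilt_def by (auto intro!: derivative_eq_intros comp)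
  moreover have "2 * u t $ 2 * perturbed_rattleback lam \<epsilon> h (u t) $ 2
      - real lam * (2 * u t $ 1 * perturbed_rattleback lam \<epsilon> h (u t) $ 1)
    = - 2 * u t $ 3 * stiffness lam (u t)
     + 2 * (real lam + 1) * \<epsilon> * (energy lam (u t) - h) * energy lam (u t) * tilt lam (u t)"
    unfolding perturbed_rattleback_components tilt_def stiffness_def energy_def pow
    by algebra
  ultimately show ?thesis by simp
qed

end

section \<open>Forward existence for the perturbed rattleback\<close>

text \<open>Boundedness is part of the notion because products of Lipschitz functions are Lipschitz only
  when the factors are bounded.\<close>

definition bounded_lipschitz :: "'a::metric_space set \<Rightarrow> ('a \<Rightarrow> real) \<Rightarrow> bool" where
  "bounded_lipschitz S f \<longleftrightarrow> (\<exists>L. L-lipschitz_on S f) \<and> bounded (f ` S)"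

lemma bounded_lipschitzI:
  assumes "\<And>x y. x \<in> S \<Longrightarrow> y \<in> S \<Longrightarrow> \<bar>f x - f y\<bar> \<le> L * dist x y"
    and "\<And>x. x \<in> S \<Longrightarrow> \<bar>f x\<bar> \<le> B"
  shows "bounded_lipschitz S f"
proof -
  have "\<bar>L\<bar>-lipschitz_on S f"
  proof (rule lipschitz_onI)
    fix x y assume "x \<in> S" "y \<in> S"
    then have "\<bar>f x - f y\<bar> \<le> L * dist x y" by (rule assms(1))
    also have "\<dots> \<le> \<bar>L\<bar> * dist x y" by (intro mult_right_mono) auto
    finally show "dist (f x) (f y) \<le> \<bar>L\<bar> * dist x y" by (simp add: dist_real_def)
  qed simp
  moreover have "bounded (f ` S)" unfolding bounded_iff using assms(2) by auto
  ultimately show ?thesis unfolding bounded_lipschitz_def by blast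
qed

lemma bounded_lipschitzE:
  assumes "bounded_lipschitz S f"
  obtains L B where "0 \<le> L" "0 \<le> B" "\<And>x y. x \<in> S \<Longrightarrow> y \<in> S \<Longrightarrow> \<bar>f x - f y\<bar> \<le> L * dist x y"
    "\<And>x. x \<in> S \<Longrightarrow> \<bar>f x\<bar> \<le> B"
proof -
  obtain L where L: "L-lipschitz_on S f" using assms unfolding bounded_lipschitz_def by blast
  obtain B where B: "0 < B" "\<And>x. x \<in> f ` S \<Longrightarrow> norm x \<le> B"
    using assms unfolding bounded_lipschitz_def bounded_pos by auto
  show thesis
    using that[of L B] B lipschitz_on_nonneg[OF L] lipschitz_onD[OF L]
    by (auto simp: dist_real_def)
qed

lemma bounded_lipschitz_const: "bounded_lipschitz S (\<lambda>_. k)"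
  by (rule bounded_lipschitzI[of _ _ 0 "\<bar>k\<bar>"]) auto

lemma bounded_lipschitz_add:
  assumes "bounded_lipschitz S f" "bounded_lipschitz S g"
  shows "bounded_lipschitz S (\<lambda>x. f x + g x)"
proof -
  obtain L B where f: "0 \<le> L" "0 \<le> B" "\<And>x y. x \<in> S \<Longrightarrow> y \<in> S \<Longrightarrow> \<bar>f x - f y\<bar> \<le> L * dist x y"
    "\<And>x. x \<in> S \<Longrightarrow> \<bar>f x\<bar> \<le> B" using bounded_lipschitzE[OF assms(1)] by blast
  obtain M C where g: "0 \<le> M" "0 \<le> C" "\<And>x y. x \<in> S \<Longrightarrow> y \<in> S \<Longrightarrow> \<bar>g x - g y\<bar> \<le> M * dist x y"
    "\<And>x. x \<in> S \<Longrightarrow> \<bar>g x\<bar> \<le> C" using bounded_lipschitzE[OF assms(2)] by blast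
  show ?thesis
  proof (rule bounded_lipschitzI[of _ _ "L + M" "B + C"])
    show "\<bar>f x + g x - (f y + g y)\<bar> \<le> (L + M) * dist x y" if "x \<in> S" "y \<in> S" for x y
      using f(3)[OF that] g(3)[OF that] by (simp add: distrib_right)
    show "\<bar>f x + g x\<bar> \<le> B + C" if "x \<in> S" for x using f(4)[OF that] g(4)[OF that] by simp
  qed
qed

lemma bounded_lipschitz_mult:
  assumes "bounded_lipschitz S f" "bounded_lipschitz S g"
  shows "bounded_lipschitz S (\<lambda>x. f x * g x)"
proof -
  obtain L B where f: "0 \<le> L" "0 \<le> B" "\<And>x y. x \<in> S \<Longrightarrow> y \<in> S \<Longrightarrow> \<bar>f x - f y\<bar> \<le> L * dist x y"
    "\<And>x. x \<in> S \<Longrightarrow> \<bar>f x\<bar> \<le> B" using bounded_lipschitzE[OF assms(1)] by blast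
  obtain M C where g: "0 \<le> M" "0 \<le> C" "\<And>x y. x \<in> S \<Longrightarrow> y \<in> S \<Longrightarrow> \<bar>g x - g y\<bar> \<le> M * dist x y"
    "\<And>x. x \<in> S \<Longrightarrow> \<bar>g x\<bar> \<le> C" using bounded_lipschitzE[OF assms(2)] by blast
  show ?thesis
  proof (rule bounded_lipschitzI[of _ _ "B * M + C * L" "B * C"])
    fix x y assume xy: "x \<in> S" "y \<in> S"
    have "\<bar>f x * g x - f y * g y\<bar> = \<bar>f x * (g x - g y) + g y * (f x - f y)\<bar>" by (simp add: algebra_simps)
    also have "\<dots> \<le> \<bar>f x\<bar> * \<bar>g x - g y\<bar> + \<bar>g y\<bar> * \<bar>f x - f y\<bar>"
      by (metis abs_mult abs_triangle_ineq)
    also have "\<dots> \<le> B * (M * dist x y) + C * (L * dist x y)"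
      using f g xy by (intro add_mono mult_mono) auto
    finally show "\<bar>f x * g x - f y * g y\<bar> \<le> (B * M + C * L) * dist x y" by (simp add: algebra_simps)
  qed (use f g in \<open>auto simp: abs_mult intro!: mult_mono\<close>)
qed

lemma bounded_lipschitz_diff:
  assumes "bounded_lipschitz S f" "bounded_lipschitz S g"
  shows "bounded_lipschitz S (\<lambda>x. f x - g x)"
  using bounded_lipschitz_add[OF assms(1) bounded_lipschitz_mult[OF bounded_lipschitz_const[of S "-1"] assms(2)]]
  by simp

lemma bounded_lipschitz_power:
  assumes "bounded_lipschitz S f"
  shows "bounded_lipschitz S (\<lambda>x. f x ^ n)"
  by (induction n) (auto intro: bounded_lipschitz_const bounded_lipschitz_mult assms)

lemma bounded_lipschitz_component:
  fixes S :: "(real^'n) set"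
  assumes "bounded S"
  shows "bounded_lipschitz S (\<lambda>v. v $ i)"
proof -
  obtain B where B: "\<And>v. v \<in> S \<Longrightarrow> norm v \<le> B" using assms bounded_iff by blast
  show ?thesis
  proof (rule bounded_lipschitzI[of _ _ 1 B])
    show "\<bar>x $ i - y $ i\<bar> \<le> 1 * dist x y" for x y :: "real^'n"
      using component_le_norm_cart[of "x - y" i] by (simp add: dist_norm)
    show "\<bar>x $ i\<bar> \<le> B" if "x \<in> S" for x
      using component_le_norm_cart[of x i] B[OF that] by simp
  qed
qed

lemma perturbed_rattleback_lipschitz:
  assumes "bounded S"
  shows "\<exists>L>0. \<forall>p\<in>S. \<forall>q\<in>S.
    norm (perturbed_rattleback lam \<epsilon> h p - perturbed_rattleback lam \<epsilon> h q) \<le> L * norm (p - q)"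
proof -
  let ?P = "perturbed_rattleback lam \<epsilon> h"
  note comp = bounded_lipschitz_component[OF assms]
  have "bounded_lipschitz S (\<lambda>v. ?P v $ 1)" "bounded_lipschitz S (\<lambda>v. ?P v $ 2)"
    "bounded_lipschitz S (\<lambda>v. ?P v $ 3)"
    unfolding perturbed_rattleback_components energy_def
    by (intro bounded_lipschitz_add bounded_lipschitz_diff bounded_lipschitz_mult
        bounded_lipschitz_power bounded_lipschitz_const
        comp bounded_lipschitz_mult[OF bounded_lipschitz_const[of S "-1"], simplified])+
  then have "bounded_lipschitz S (\<lambda>v. ?P v $ i)" for i
    using exhaust_3[of i] by auto
  then have "\<exists>L. 0 \<le> L \<and> (\<forall>p\<in>S. \<forall>q\<in>S. \<bar>?P p $ i - ?P q $ i\<bar> \<le> L * dist p q)" for i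
    by (meson bounded_lipschitzE)
  then obtain L where L: "\<And>i. 0 \<le> L i"
    "\<And>i p q. p \<in> S \<Longrightarrow> q \<in> S \<Longrightarrow> \<bar>?P p $ i - ?P q $ i\<bar> \<le> L i * dist p q" by metis
  define K where "K = sum L UNIV + 1"
  show ?thesis
  proof (intro exI[of _ K] conjI ballI)
    show "0 < K" using sum_nonneg[of UNIV L] L(1) by (simp add: K_def add_nonneg_pos)
    fix p q assume pq: "p \<in> S" "q \<in> S"
    have "norm (?P p - ?P q) \<le> (\<Sum>i\<in>UNIV. \<bar>(?P p - ?P q) $ i\<bar>)" by (rule norm_le_l1_cart)
    also have "\<dots> \<le> (\<Sum>i\<in>UNIV. L i * dist p q)" using L(2)[OF pq] by (intro sum_mono) simp
    also have "\<dots> \<le> K * dist p q" by (simp add: K_def sum_distrib_right distrib_right)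
    finally show "norm (?P p - ?P q) \<le> K * norm (p - q)" by (simp add: dist_norm)
  qed
qed

lemma closest_point_cball_scaled:
  fixes v :: "'a::euclidean_space"
  assumes "0 < R"
  obtains k where "v = k *\<^sub>R closest_point (cball 0 R) v"
proof (cases "norm v \<le> R")
  case True
  then have "closest_point (cball 0 R) v = v" by (intro closest_point_self) simp
  then show thesis using that[of 1] by simp
next
  case False
  have "(R / norm v) *\<^sub>R v = closest_point (cball 0 R) v"
  proof (rule closest_point_unique)
    have "dist v ((R / norm v) *\<^sub>R v) = norm ((1 - R / norm v) *\<^sub>R v)"
      by (simp add: dist_norm algebra_simps)
    also have "\<dots> = (1 - R / norm v) * norm v"
    proof -
      have "R / norm v \<le> 1" using False assms by (simp add: divide_le_eq_1)
      then show ?thesis by (simp only: norm_scaleR abs_of_nonneg[of "1 - R / norm v"] diff_ge_0_iff_ge)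
    qed
    also have "\<dots> = norm v - R" using False assms by (auto simp: left_diff_distrib)
    finally have near: "dist v ((R / norm v) *\<^sub>R v) = norm v - R" .
    show "\<forall>z\<in>cball 0 R. dist v ((R / norm v) *\<^sub>R v) \<le> dist v z"
    proof
      fix z :: 'a
      assume "z \<in> cball 0 R"
      then have "norm z \<le> R" by simp
      then show "dist v ((R / norm v) *\<^sub>R v) \<le> dist v z"
        using norm_triangle_ineq2[of v z] near by (simp add: dist_norm)
    qed
  qed (use assms in auto)
  then have "v = (norm v / R) *\<^sub>R closest_point (cball 0 R) v"
    using False assms by (auto simp flip: \<open>(R / norm v) *\<^sub>R v = closest_point (cball 0 R) v\<close>)
  then show thesis by (rule that)
qed

text \<open>The field is composed with the nearest-point projection onto a large ball, which makes it globally
  Lipschitz. The projection of a point is a multiple of it, and the field is orthogonal to its argument, so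
  the solution of the truncated equation keeps its norm, never leaves the ball, and therefore solves
  the original equation.\<close>

lemma perturbed_rattleback_half_line_solution:
  "\<exists>u. solution_on (perturbed_rattleback lam \<epsilon> h) UNIV {0..} u \<and> u 0 = a"
proof -
  let ?P = "perturbed_rattleback lam \<epsilon> h"
  define R where "R = norm a + 1"
  have R: "0 < R" by (simp add: R_def add_nonneg_pos)
  define c where "c = closest_point (cball (0::real^3) R)"
  have c_in: "c v \<in> cball 0 R" for v
    unfolding c_def by (rule closest_point_in_set) (use R in auto)
  have c_lip: "norm (c p - c q) \<le> norm (p - q)" for p q
    unfolding c_def dist_norm[symmetric] by (rule closest_point_lipschitz) (use R in auto)
  obtain L where L: "0 < L" "\<And>p q. p \<in> cball 0 R \<Longrightarrow> q \<in> cball 0 R \<Longrightarrow> norm (?P p - ?P q) \<le> L * norm (p - q)"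
    using perturbed_rattleback_lipschitz[OF bounded_cball, of 0 R lam \<epsilon> h] by blast
  have "norm (?P (c p) - ?P (c q)) \<le> L * norm (p - q)" for p q
    using L(2)[OF c_in c_in] mult_left_mono[OF c_lip, of L] L(1) by (meson less_imp_le order_trans)
  from lipschitz_field_half_line_solution[of "?P \<circ> c", unfolded comp_def, OF this L(1)]
  obtain u where u: "solution_on (\<lambda>v. ?P (c v)) UNIV {0..} u" "u 0 = a" by blast
  have "((\<lambda>t. u t \<bullet> u t) has_real_derivative 0) (at t within {0..})" if "0 \<le> t" for t
  proof -
    have "(u has_vector_derivative ?P (c (u t))) (at t within {0..})"
      using u that by (simp add: solution_on_def)
    from bounded_bilinear.has_vector_derivative[OF bounded_bilinear_inner this this]
    have "((\<lambda>t. u t \<bullet> u t) has_real_derivative 2 * (u t \<bullet> ?P (c (u t)))) (at t within {0..})"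
      by (simp add: has_real_derivative_iff_has_vector_derivative inner_commute)
    moreover obtain k where "u t = k *\<^sub>R c (u t)"
      using closest_point_cball_scaled[OF R] unfolding c_def by blast
    then have "u t \<bullet> ?P (c (u t)) = k * (c (u t) \<bullet> ?P (c (u t)))"
      by (metis inner_scaleR_left)
    ultimately show ?thesis by (simp add: perturbed_rattleback_tangent)
  qed
  then obtain k where k: "\<And>t. 0 \<le> t \<Longrightarrow> u t \<bullet> u t = k"
    using has_field_derivative_zero_constant[of "{0..}" "\<lambda>t. u t \<bullet> u t"] by auto
  have "norm (u t) = norm a" if "0 \<le> t" for t
    using k[OF that] k[of 0] u(2) by (simp add: norm_eq_sqrt_inner)
  then have "c (u t) = u t" if "0 \<le> t" for t
    unfolding c_def using that by (intro closest_point_self) (simp add: R_def)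
  then have "solution_on ?P UNIV {0..} u" using u(1) by (simp add: solution_on_def)
  then show ?thesis using u(2) by blast
qed

section \<open>Polar coordinates in the plane of height and tilt\<close>

definition amplitude :: "nat \<Rightarrow> real^3 \<Rightarrow> real" where
  "amplitude lam v = sqrt ((v$3)\<^sup>2 + (tilt lam v)\<^sup>2)"

definition has_angle :: "nat \<Rightarrow> real^3 \<Rightarrow> real \<Rightarrow> bool" where
  "has_angle lam v \<alpha> \<longleftrightarrow>
     v$3 = amplitude lam v * sin \<alpha> \<and> tilt lam v = amplitude lam v * cos \<alpha>"

text \<open>The angular velocity of \<open>(tilt, height)\<close> under the unperturbed rattleback.\<close>

definition rotation :: "nat \<Rightarrow> real^3 \<Rightarrow> real" where
  "rotation lam v =
     ((tilt lam v)\<^sup>2 + 2 * (v$3)\<^sup>2 * stiffness lam v) / ((v$3)\<^sup>2 + (tilt lam v)\<^sup>2)"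

lemma amplitude_squared: "(amplitude lam v)\<^sup>2 = (v$3)\<^sup>2 + (tilt lam v)\<^sup>2"
  by (simp add: amplitude_def)

lemma amplitude_nonneg: "0 \<le> amplitude lam v"
  by (simp add: amplitude_def)

lemma has_angle_exists: "\<exists>\<alpha>. has_angle lam v \<alpha>"
  using polar_angle_exists[of "v$3" "tilt lam v"] unfolding has_angle_def amplitude_def by metis

lemma has_angle_add_full_turns: "has_angle lam v (\<alpha> + 2 * pi * of_int n) \<longleftrightarrow> has_angle lam v \<alpha>"
proof -
  have "sin (\<alpha> + 2 * pi * of_int n) = sin \<alpha>" "cos (\<alpha> + 2 * pi * of_int n) = cos \<alpha>"
    by (simp_all add: sin_add cos_add)
  then show ?thesis by (simp add: has_angle_def)
qed

lemma continuous_on_state_functions [continuous_intros]: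
  fixes u :: "'a::topological_space \<Rightarrow> real^3"
  assumes "continuous_on S u"
  shows "continuous_on S (\<lambda>t. casimir (u t))" "continuous_on S (\<lambda>t. energy lam (u t))"
    "continuous_on S (\<lambda>t. tilt lam (u t))" "continuous_on S (\<lambda>t. stiffness lam (u t))"
    "continuous_on S (\<lambda>t. amplitude lam (u t))"
  unfolding casimir_def energy_def tilt_def stiffness_def amplitude_def
  by (intro continuous_intros assms)+

lemma continuous_on_rotation:
  assumes "continuous_on S u" "\<And>t. t \<in> S \<Longrightarrow> amplitude lam (u t) \<noteq> 0"
  shows "continuous_on S (\<lambda>t. rotation lam (u t))"
proof -
  have "continuous_on S (\<lambda>t. ((tilt lam (u t))\<^sup>2 + 2 * (u t $ 3)\<^sup>2 * stiffness lam (u t))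
      / ((u t $ 3)\<^sup>2 + (tilt lam (u t))\<^sup>2))"
    using assms(2) by (intro continuous_intros assms(1)) (auto simp: amplitude_def)
  then show ?thesis by (simp add: rotation_def)
qed

text \<open>On a sphere of constant Casimir, height and tilt determine \<open>x\<close> and \<open>y\<close> up to sign, and even the
  stiffness is a polynomial in them.\<close>

lemma sphere_coordinates:
  assumes "casimir v = c"
  shows "(real lam + 1) * (v$1)\<^sup>2 = 2 * c - (v$3)\<^sup>2 - tilt lam v"
    and "(real lam + 1) * (v$2)\<^sup>2 = tilt lam v + real lam * (2 * c - (v$3)\<^sup>2)"
    and "stiffness lam v = real lam * (2 * c - (v$3)\<^sup>2) + (1 - real lam) * tilt lam v"
proof -
  have "2 * c = (v$1)\<^sup>2 + (v$2)\<^sup>2 + (v$3)\<^sup>2" using assms by (simp add: casimir_def)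
  then show "(real lam + 1) * (v$1)\<^sup>2 = 2 * c - (v$3)\<^sup>2 - tilt lam v"
    "(real lam + 1) * (v$2)\<^sup>2 = tilt lam v + real lam * (2 * c - (v$3)\<^sup>2)"
    "stiffness lam v = real lam * (2 * c - (v$3)\<^sup>2) + (1 - real lam) * tilt lam v"
    unfolding tilt_def stiffness_def by algebra+
qed

lemma concave_quadratic_ge_on_segment:
  fixes p q e :: real
  assumes "0 \<le> e" "r \<le> \<xi>" "\<xi> \<le> \<rho>"
    and "a \<le> p + q * r - e * r\<^sup>2" "a \<le> p + q * \<rho> - e * \<rho>\<^sup>2"
  shows "a \<le> p + q * \<xi> - e * \<xi>\<^sup>2"
proof (cases "0 \<le> q - e * (\<xi> + r)")
  case True
  then have "0 \<le> (\<xi> - r) * (q - e * (\<xi> + r))" using assms by (intro mult_nonneg_nonneg) auto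
  also have "\<dots> = (p + q * \<xi> - e * \<xi>\<^sup>2) - (p + q * r - e * r\<^sup>2)"
    by (simp add: algebra_simps power2_eq_square)
  finally show ?thesis using assms by linarith
next
  case False
  have "e * (\<xi> + r) \<le> e * (\<xi> + \<rho>)" using assms by (intro mult_left_mono) auto
  then have "0 \<le> (\<rho> - \<xi>) * (e * (\<xi> + \<rho>) - q)"
    using False assms by (intro mult_nonneg_nonneg) auto
  also have "\<dots> = (p + q * \<xi> - e * \<xi>\<^sup>2) - (p + q * \<rho> - e * \<rho>\<^sup>2)"
    by (simp add: algebra_simps power2_eq_square)
  finally show ?thesis using assms by linarith
qed

text \<open>Up to a constant factor, \<open>A r * D r ^ lam\<close> is the squared energy at the point of amplitude \<open>r\<close> on the ray
  with direction \<open>(s, k)\<close>, since \<open>A = (lam + 1) * x\<^sup>2\<close> and \<open>D = (lam + 1) * y\<^sup>2\<close> there. Its derivative in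
  \<open>r\<close> is \<open>- r * D ^ (lam - 1)\<close> times a positive combination of \<open>k\<^sup>2\<close> and \<open>s\<^sup>2\<close>, hence bounded away from zero as
  long as \<open>A\<close>, \<open>D\<close> and \<open>r\<close> are. Both \<open>A\<close> and \<open>D\<close> are concave in \<open>r\<close>, so bounds at the two ends of a
  segment persist between them. Each level curve of the energy thus meets a ray at most once, and
  the amplitude there is a Lipschitz function of the squared energy.\<close>

lemma energy_along_ray:
  fixes c s k a b r \<rho> :: real and lam :: nat
  defines "A \<equiv> \<lambda>r. 2 * c - s\<^sup>2 * r\<^sup>2 - k * r"
    and "D \<equiv> \<lambda>r. k * r + real lam * (2 * c - s\<^sup>2 * r\<^sup>2)"
  assumes unit: "s\<^sup>2 + k\<^sup>2 = 1" and lam: "0 < lam" and pos: "0 < a" "0 < b"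
    and "b \<le> r" "b \<le> \<rho>" "a \<le> A r" "a \<le> A \<rho>" "a \<le> D r" "a \<le> D \<rho>"
  shows "a ^ (lam - 1) * b * min 1 a * \<bar>r - \<rho>\<bar> \<le> \<bar>A r * D r ^ lam - A \<rho> * D \<rho> ^ lam\<bar>"
proof -
  define f where "f r = A r * D r ^ lam" for r
  define f' where "f' r = - (D r ^ (lam - 1) * r * ((real lam + 1) * k\<^sup>2 + 2 * s\<^sup>2 * (D r + (real lam)\<^sup>2 * A r)))" for r
  have der: "(f has_real_derivative f' r) (at r)" for r
  proof -
    have "(A has_real_derivative - (2 * s\<^sup>2 * r) - k) (at r)"
      unfolding A_def by (auto intro!: derivative_eq_intros)
    moreover have "(D has_real_derivative k - real lam * (2 * s\<^sup>2 * r)) (at r)"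
      unfolding D_def by (auto intro!: derivative_eq_intros)
    ultimately have "(f has_real_derivative
        (- (2 * s\<^sup>2 * r) - k) * D r ^ lam + (real lam * D r ^ (lam - 1) * (k - real lam * (2 * s\<^sup>2 * r))) * A r) (at r)"
      unfolding f_def[abs_def] by (auto intro!: derivative_eq_intros)
    moreover have "D r ^ lam = D r * D r ^ (lam - 1)" using lam by (cases lam) auto
    moreover have "D r = k * r + real lam * (2 * c - s\<^sup>2 * r\<^sup>2)" "A r = 2 * c - s\<^sup>2 * r\<^sup>2 - k * r"
      by (simp_all add: D_def A_def)
    then have "(- (2 * s\<^sup>2 * r) - k) * (D r * Y) + (real lam * Y * (k - real lam * (2 * s\<^sup>2 * r))) * A r
      = - (Y * r * ((real lam + 1) * k\<^sup>2 + 2 * s\<^sup>2 * (D r + (real lam)\<^sup>2 * A r)))" for Y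
      by algebra
    ultimately show ?thesis unfolding f'_def by simp
  qed
  have slope: "a ^ (lam - 1) * b * min 1 a * (\<rho> - r) \<le> \<bar>f r - f \<rho>\<bar>"
    if "r < \<rho>" "b \<le> r" "a \<le> A r" "a \<le> A \<rho>" "a \<le> D r" "a \<le> D \<rho>" for r \<rho>
  proof -
    obtain \<xi> where \<xi>: "r < \<xi>" "\<xi> < \<rho>" "f \<rho> - f r = (\<rho> - r) * f' \<xi>"
      using MVT2[OF \<open>r < \<rho>\<close>, of f f'] der by blast
    have "a \<le> 2 * c + (- k) * \<xi> - s\<^sup>2 * \<xi>\<^sup>2"
      by (rule concave_quadratic_ge_on_segment[of _ r _ \<rho>])
         (use \<xi> that in \<open>auto simp: A_def algebra_simps\<close>)
    then have Ax: "a \<le> A \<xi>" by (simp add: A_def)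
    have "a \<le> real lam * (2 * c) + k * \<xi> - (real lam * s\<^sup>2) * \<xi>\<^sup>2"
      by (rule concave_quadratic_ge_on_segment[of _ r _ \<rho>])
         (use \<xi> that in \<open>auto simp: D_def algebra_simps\<close>)
    then have Dx: "a \<le> D \<xi>" by (simp add: D_def algebra_simps)
    have "min 1 a * 1 = min 1 a * k\<^sup>2 + min 1 a * s\<^sup>2" using unit by algebra
    also have "\<dots> \<le> (real lam + 1) * k\<^sup>2 + (2 * (D \<xi> + (real lam)\<^sup>2 * A \<xi>)) * s\<^sup>2"
    proof (intro add_mono mult_right_mono)
      have "min 1 a \<le> 2 * (x + y)" if "a \<le> x" "0 \<le> y" for x y
        using that pos by (auto simp: min_def)
      then show "min 1 a \<le> 2 * (D \<xi> + (real lam)\<^sup>2 * A \<xi>)"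
        using Dx Ax pos by simp
    qed auto
    finally have "min 1 a \<le> (real lam + 1) * k\<^sup>2 + 2 * s\<^sup>2 * (D \<xi> + (real lam)\<^sup>2 * A \<xi>)"
      by (simp add: algebra_simps)
    then have "a ^ (lam - 1) * b * min 1 a \<le> - f' \<xi>"
      unfolding f'_def minus_minus
      using pos Dx \<xi> that by (intro mult_mono power_mono) auto
    then have "a ^ (lam - 1) * b * min 1 a * (\<rho> - r) \<le> - f' \<xi> * (\<rho> - r)"
      using \<open>r < \<rho>\<close> by (intro mult_right_mono) auto
    also have "\<dots> \<le> \<bar>f r - f \<rho>\<bar>" using \<xi>(3) by (simp add: mult.commute)
    finally show ?thesis .
  qed
  consider "r < \<rho>" | "\<rho> < r" | "r = \<rho>" by linarith
  then show ?thesis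
    using slope[of r \<rho>] slope[of \<rho> r] assms by cases (auto simp: f_def abs_minus_commute)
qed

section \<open>A collar of the level curve\<close>

text \<open>The number \<open>\<eta>\<close> is the half-width of a band of energies around \<open>h\<close> which contains neither \<open>0\<close> nor
  the extreme values of the energy on the sphere \<open>casimir = c\<close>, whose square is the right-hand side of
  the last assumption. Of \<open>\<sigma>\<close> only the sign matters: it selects the half space \<open>y > 0\<close> or \<open>y < 0\<close>, so
  that both components of the fibre are treated at once.\<close>

locale rattleback_level =
  fixes lam :: nat and c h \<eta> \<sigma> :: real
  assumes lam: "1 < lam" and c: "0 < c" and \<eta>: "0 < \<eta>" "\<eta> < \<bar>h\<bar>" and \<sigma>: "\<sigma> \<noteq> 0"
    and below_crest:
      "(\<bar>h\<bar> + \<eta>)\<^sup>2 < real lam ^ lam * (2 / (real lam + 1)) ^ (lam + 1) * c ^ (lam + 1)"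
begin

definition collar :: "(real^3) set" where
  "collar = {v. casimir v = c \<and> \<bar>energy lam v - h\<bar> \<le> \<eta> \<and> 0 < \<sigma> * v$2}"

definition cycle :: "(real^3) set" where
  "cycle = {v. casimir v = c \<and> energy lam v = h \<and> 0 < \<sigma> * v$2}"

lemma cycle_subset_collar: "cycle \<subseteq> collar"
  using \<eta> by (auto simp: cycle_def collar_def)

lemma collar_casimir: "v \<in> collar \<Longrightarrow> casimir v = c"
  by (simp add: collar_def)

lemma energy_near_h_nonzero: "\<bar>energy lam v - h\<bar> \<le> \<eta> \<Longrightarrow> energy lam v \<noteq> 0 \<and> v$1 \<noteq> 0 \<and> v$2 \<noteq> 0"
  using \<eta> lam by (auto simp: energy_def zero_power)

lemma collar_abs_energy: "v \<in> collar \<Longrightarrow> \<bar>energy lam v\<bar> \<le> \<bar>h\<bar> + \<eta>"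
  by (auto simp: collar_def)

lemma collar_energy_same_sign:
  assumes "u \<in> collar" "v \<in> collar"
  shows "0 < energy lam u * energy lam v"
  using assms \<eta> unfolding collar_def by (smt (verit) mem_Collect_eq mult_neg_neg mult_pos_pos)

text \<open>If height and tilt vanish then \<open>y\<^sup>2 = lam * x\<^sup>2\<close> and \<open>x\<^sup>2 + y\<^sup>2 = 2 * c\<close>, and the energy takes an
  extreme value on the sphere, which the band excludes.\<close>

lemma collar_amplitude_pos:
  assumes v: "v \<in> collar"
  shows "0 < amplitude lam v"
proof (rule ccontr)
  assume "\<not> 0 < amplitude lam v"
  then have "(v$3)\<^sup>2 + (tilt lam v)\<^sup>2 \<le> 0"
    unfolding amplitude_def by simp
  then have zw: "v$3 = 0" "tilt lam v = 0" by (simp_all add: sum_power2_le_zero_iff)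
  define X where "X = (v$1)\<^sup>2"
  have X: "X = 2 / (real lam + 1) * c" "(v$2)\<^sup>2 = real lam * X"
    using sphere_coordinates(1)[OF collar_casimir[OF v], of lam] zw
    by (simp_all add: X_def tilt_def field_simps)
  have "(energy lam v)\<^sup>2 = X * ((v$2)\<^sup>2) ^ lam"
    by (simp add: energy_def X_def power_mult_distrib power_mult[symmetric] mult.commute)
  also have "\<dots> = real lam ^ lam * X ^ (lam + 1)" by (simp add: X(2) power_mult_distrib)
  also have "\<dots> = real lam ^ lam * (2 / (real lam + 1)) ^ (lam + 1) * c ^ (lam + 1)"
    by (simp only: X(1) power_mult_distrib mult.assoc)
  finally have "(\<bar>h\<bar> + \<eta>)\<^sup>2 < (energy lam v)\<^sup>2" using below_crest by simp
  moreover have "(energy lam v)\<^sup>2 \<le> (\<bar>h\<bar> + \<eta>)\<^sup>2"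
    using power_mono[OF collar_abs_energy[OF v], of 2] by simp
  ultimately show False by simp
qed

text \<open>The strict inequality in the definition may be relaxed: zero energy is excluded, so \<open>y = 0\<close> cannot
  occur.\<close>

lemma collar_compact: "compact collar"
proof -
  have eq: "collar = {v. casimir v = c} \<inter> {v. \<bar>energy lam v - h\<bar> \<le> \<eta>} \<inter> {v. 0 \<le> \<sigma> * v$2}"
    using energy_near_h_nonzero \<sigma> by (auto simp: collar_def less_le)
  have "closed collar"
    unfolding eq
    by (intro closed_Int closed_Collect_eq closed_Collect_le continuous_intros)
  moreover have "collar \<subseteq> cball 0 (sqrt (2 * c))"
    using real_le_rsqrt by (fastforce simp: collar_def casimir_eq_norm)
  ultimately show ?thesis using bounded_cball bounded_subset compact_eq_bounded_closed by blast
qed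

lemma collar_bounds:
  obtains a b where "0 < a" "0 < b"
    and "\<And>v. v \<in> collar \<Longrightarrow> a \<le> (v$1)\<^sup>2 \<and> a \<le> (v$2)\<^sup>2 \<and> a \<le> amplitude lam v \<and> amplitude lam v \<le> b"
proof (cases "collar = {}")
  case True
  then show thesis using that[of 1 1] by simp
next
  case False
  define f where "f v = min (min ((v$1)\<^sup>2) ((v$2)\<^sup>2)) (amplitude lam v)" for v :: "real^3"
  have "continuous_on collar f" unfolding f_def by (intro continuous_intros)
  from continuous_attains_inf[OF collar_compact False this]
  obtain p where p: "p \<in> collar" "\<And>v. v \<in> collar \<Longrightarrow> f p \<le> f v" by blast
  have "continuous_on collar (amplitude lam)"
    using continuous_on_state_functions(5)[OF continuous_on_id, of collar lam] by simp
  from continuous_attains_sup[OF collar_compact False this]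
  obtain q where q: "q \<in> collar" "\<And>v. v \<in> collar \<Longrightarrow> amplitude lam v \<le> amplitude lam q" by blast
  show thesis
  proof (rule that[of "f p" "amplitude lam q"])
    show "0 < f p"
      using p(1) energy_near_h_nonzero[of p] collar_amplitude_pos[of p] by (simp add: f_def collar_def)
    show "0 < amplitude lam q" using q(1) by (rule collar_amplitude_pos)
  qed (use p(2) q(2) in \<open>force simp: f_def\<close>)
qed

end

section \<open>Invariance of the collar and comparison along rays\<close>

context rattleback_level
begin

text \<open>The energy gap does not grow, so the energy stays away from zero, \<open>y\<close> never vanishes, and by
  continuity the solution cannot change half spaces.\<close>

lemma forward_invariant:
  assumes "0 \<le> \<epsilon>" and u: "solution_on (perturbed_rattleback lam \<epsilon> h) S {0..} u"
    and u0: "u 0 \<in> collar" and "0 \<le> t"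
  shows "u t \<in> collar" "\<bar>energy lam (u t) - h\<bar> \<le> \<bar>energy lam (u 0) - h\<bar>"
proof -
  have lam0: "0 < lam" using lam by simp
  define E where "E t = (energy lam (u t) - h)\<^sup>2" for t
  have "(E has_real_derivative - (2 * \<epsilon> * E t * dissipation lam (u t))) (at t within {0..})" if "0 \<le> t" for t
    unfolding E_def[abs_def] using energy_derivative[OF lam0 u, of t] that
    by (auto intro!: derivative_eq_intros simp: power2_eq_square)
  moreover have "- (2 * \<epsilon> * E t * dissipation lam (u t)) \<le> 0" for t
    using \<open>0 \<le> \<epsilon>\<close> by (simp add: E_def dissipation_def stiffness_def)
  ultimately have "E t \<le> E 0" if "0 \<le> t" for t
    using half_line_nonincreasing[of E "\<lambda>t. - (2 * \<epsilon> * E t * dissipation lam (u t))" 0 t] that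
    by simp
  then have near: "\<bar>energy lam (u t) - h\<bar> \<le> \<bar>energy lam (u 0) - h\<bar>" if "0 \<le> t" for t
    using that by (simp add: E_def abs_le_square_iff)
  have cas: "casimir (u t) = c"
  proof -
    have "((\<lambda>t. casimir (u t)) has_real_derivative 0) (at s within {0..})" if "s \<in> {0..}" for s
      using casimir_derivative[OF lam0 u that] .
    then obtain k where "\<And>s. 0 \<le> s \<Longrightarrow> casimir (u s) = k"
      using has_field_derivative_zero_constant[of "{0..}" "\<lambda>t. casimir (u t)"] by auto
    then show ?thesis using \<open>0 \<le> t\<close> u0 by (auto simp: collar_def)
  qed
  have band: "\<bar>energy lam (u t) - h\<bar> \<le> \<eta>" if "0 \<le> t" for t
    using near[OF that] u0 by (auto simp: collar_def)
  have "0 < \<sigma> * u t $ 2"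
  proof (rule ccontr)
    assume neg: "\<not> 0 < \<sigma> * u t $ 2"
    have "continuous_on {0..t} u"
      by (rule continuous_on_subset[OF solution_continuous_on[OF u]]) auto
    then have "continuous_on {0..t} (\<lambda>s. \<sigma> * u s $ 2)" by (intro continuous_intros)
    then obtain s where "0 \<le> s" "\<sigma> * u s $ 2 = 0"
      using IVT2'[of "\<lambda>s. \<sigma> * u s $ 2" t 0 0] neg u0 \<open>0 \<le> t\<close> by (auto simp: collar_def)
    then show False using energy_near_h_nonzero[OF band[of s]] \<sigma> by simp
  qed
  then show "u t \<in> collar" using cas band[OF \<open>0 \<le> t\<close>] by (simp add: collar_def)
  show "\<bar>energy lam (u t) - h\<bar> \<le> \<bar>energy lam (u 0) - h\<bar>" using near \<open>0 \<le> t\<close> .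
qed

text \<open>Away from \<open>y = 0\<close> the stiffness is positive, so both the dissipation and the rotation control the full
  squared amplitude.\<close>

lemma tilt_spring_bound:
  assumes "a \<le> (v$2)\<^sup>2" "0 < a"
  shows "min 1 a * (amplitude lam v)\<^sup>2 \<le> (tilt lam v)\<^sup>2 + (v$3)\<^sup>2 * stiffness lam v"
proof -
  have "a \<le> stiffness lam v" using assms by (simp add: stiffness_def add_increasing2)
  then have "min 1 a * (v$3)\<^sup>2 \<le> stiffness lam v * (v$3)\<^sup>2" "min 1 a * (tilt lam v)\<^sup>2 \<le> 1 * (tilt lam v)\<^sup>2"
    by (intro mult_right_mono; simp)+
  then show ?thesis by (simp add: amplitude_squared algebra_simps)
qed

text \<open>By compactness the dissipation is bounded away from zero on the collar, so the squared energy gap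
  satisfies a linear differential inequality.\<close>

lemma energy_gap_decays:
  assumes "0 < \<epsilon>"
  obtains k where "0 < k"
    and "\<And>S u t. solution_on (perturbed_rattleback lam \<epsilon> h) S {0..} u \<Longrightarrow> u 0 \<in> collar \<Longrightarrow> 0 \<le> t \<Longrightarrow>
       \<bar>energy lam (u t) - h\<bar> \<le> \<bar>energy lam (u 0) - h\<bar> * exp (- k * t)"
proof -
  have lam0: "0 < lam" using lam by simp
  obtain a b where a: "0 < a" and bounds:
    "\<And>v. v \<in> collar \<Longrightarrow> a \<le> (v$1)\<^sup>2 \<and> a \<le> (v$2)\<^sup>2 \<and> a \<le> amplitude lam v \<and> amplitude lam v \<le> b"
    using collar_bounds by metis
  define q where "q = a ^ (lam - 1) * (min 1 a * a\<^sup>2)"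
  have q: "q \<le> dissipation lam v" if "v \<in> collar" for v
  proof -
    have "min 1 a * a\<^sup>2 \<le> min 1 a * (amplitude lam v)\<^sup>2"
      using bounds[OF that] a by (intro mult_left_mono power_mono) auto
    also have "\<dots> \<le> (tilt lam v)\<^sup>2 + (v$3)\<^sup>2 * stiffness lam v"
      using bounds[OF that] a by (intro tilt_spring_bound) auto
    finally have 1: "min 1 a * a\<^sup>2 \<le> (tilt lam v)\<^sup>2 + (v$3)\<^sup>2 * stiffness lam v" .
    have "a ^ (lam - 1) \<le> ((v$2)\<^sup>2) ^ (lam - 1)"
      using bounds[OF that] a by (intro power_mono) auto
    also have "\<dots> = ((v$2) ^ (lam - 1))\<^sup>2" by (metis power_mult mult.commute)
    finally show ?thesis unfolding q_def dissipation_def using 1 a by (intro mult_mono) auto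
  qed
  have q0: "0 < q" using a by (simp add: q_def)
  show thesis
  proof (rule that[of "\<epsilon> * q"])
    show "0 < \<epsilon> * q" using \<open>0 < \<epsilon>\<close> q0 by simp
    fix S u t
    assume u: "solution_on (perturbed_rattleback lam \<epsilon> h) S {0..} u" and u0: "u 0 \<in> collar" and "0 \<le> (t::real)"
    define E where "E t = (energy lam (u t) - h)\<^sup>2" for t
    have "(E has_real_derivative - (2 * \<epsilon> * E t * dissipation lam (u t))) (at t within {0..})" if "0 \<le> t" for t
      unfolding E_def[abs_def] using energy_derivative[OF lam0 u, of t] that
      by (auto intro!: derivative_eq_intros simp: power2_eq_square)
    moreover have "- (2 * \<epsilon> * E t * dissipation lam (u t)) \<le> - (2 * (\<epsilon> * q)) * E t" if "0 \<le> t" for t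
    proof -
      have "u t \<in> collar" using forward_invariant(1)[OF _ u u0 that] \<open>0 < \<epsilon>\<close> by simp
      then have "2 * \<epsilon> * E t * q \<le> 2 * \<epsilon> * E t * dissipation lam (u t)"
        using q \<open>0 < \<epsilon>\<close> by (intro mult_left_mono) (auto simp: E_def)
      then show ?thesis by (simp add: mult_ac)
    qed
    ultimately have "E t \<le> E 0 * exp (- (2 * (\<epsilon> * q)) * t)"
      using \<open>0 \<le> t\<close> by (rule half_line_gronwall)
    also have "\<dots> = (\<bar>energy lam (u 0) - h\<bar> * exp (- (\<epsilon> * q) * t))\<^sup>2"
      by (simp add: E_def power_mult_distrib exp_double[symmetric] mult_ac)
    finally show "\<bar>energy lam (u t) - h\<bar> \<le> \<bar>energy lam (u 0) - h\<bar> * exp (- (\<epsilon> * q) * t)"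
      unfolding E_def by - (rule power2_le_imp_le, auto)
  qed
qed

lemma rotation_bound:
  assumes "a \<le> (v$2)\<^sup>2" "0 < a" "0 < amplitude lam v"
  shows "min 1 a \<le> rotation lam v"
proof -
  have "0 \<le> (v$3)\<^sup>2 * stiffness lam v" by (simp add: stiffness_def)
  then have "min 1 a * (amplitude lam v)\<^sup>2 \<le> (tilt lam v)\<^sup>2 + 2 * (v$3)\<^sup>2 * stiffness lam v"
    using tilt_spring_bound[OF assms(1,2)] by (simp add: mult.assoc)
  then show ?thesis
    using assms(3) unfolding rotation_def amplitude_squared[symmetric] by (simp add: pos_le_divide_eq)
qed

lemma ray_coordinates:
  assumes v: "v \<in> collar" and ang: "has_angle lam v \<alpha>"
  defines "r \<equiv> amplitude lam v" and "s \<equiv> sin \<alpha>" and "k \<equiv> cos \<alpha>"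
  shows "(real lam + 1) * (v$1)\<^sup>2 = 2 * c - s\<^sup>2 * r\<^sup>2 - k * r"
    and "(real lam + 1) * (v$2)\<^sup>2 = k * r + real lam * (2 * c - s\<^sup>2 * r\<^sup>2)"
    and "rotation lam v = k\<^sup>2 + 2 * s\<^sup>2 * (real lam * (2 * c - s\<^sup>2 * r\<^sup>2) + (1 - real lam) * (k * r))"
proof -
  have zw: "v$3 = r * s" "tilt lam v = r * k"
    using ang by (simp_all add: has_angle_def r_def s_def k_def)
  note sph = sphere_coordinates[OF collar_casimir[OF v], of lam, unfolded zw]
  show "(real lam + 1) * (v$1)\<^sup>2 = 2 * c - s\<^sup>2 * r\<^sup>2 - k * r"
    "(real lam + 1) * (v$2)\<^sup>2 = k * r + real lam * (2 * c - s\<^sup>2 * r\<^sup>2)"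
    using sph by (simp_all add: power_mult_distrib mult.commute)
  have r: "0 < r" using collar_amplitude_pos[OF v] by (simp add: r_def)
  have "rotation lam v = ((tilt lam v)\<^sup>2 + 2 * (v$3)\<^sup>2 * stiffness lam v) / r\<^sup>2"
    unfolding rotation_def r_def amplitude_squared ..
  also have "\<dots> = (r\<^sup>2 * (k\<^sup>2 + 2 * s\<^sup>2 * stiffness lam v)) / r\<^sup>2"
    unfolding zw by (simp add: power_mult_distrib algebra_simps)
  also have "\<dots> = k\<^sup>2 + 2 * s\<^sup>2 * stiffness lam v" using r by simp
  finally show "rotation lam v = k\<^sup>2 + 2 * s\<^sup>2 * (real lam * (2 * c - s\<^sup>2 * r\<^sup>2) + (1 - real lam) * (k * r))"
    unfolding sph(3) by (simp add: power_mult_distrib mult.commute)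
qed

text \<open>The quantitative core: two points of the collar on the same ray are close when their energies are.
  Their amplitudes differ by at most a multiple of the energy difference by \<open>energy_along_ray\<close>, and every other
  quantity is a function of amplitude and angle. For \<open>x\<close> and \<open>y\<close> only the squares are polynomials
  in the amplitude, which is why the estimate of the distance is for its square.\<close>

lemma same_angle_comparison:
  obtains L where "0 < L"
    and "\<And>u v \<alpha>. u \<in> collar \<Longrightarrow> v \<in> collar \<Longrightarrow> has_angle lam u \<alpha> \<Longrightarrow> has_angle lam v \<alpha> \<Longrightarrow>
       \<bar>rotation lam u - rotation lam v\<bar> \<le> L * \<bar>energy lam u - energy lam v\<bar> \<and>
       (norm (u - v))\<^sup>2 \<le> L * \<bar>energy lam u - energy lam v\<bar>"
proof -
  obtain a b where a: "0 < a" "0 < b" and bounds: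
    "\<And>v. v \<in> collar \<Longrightarrow> a \<le> (v$1)\<^sup>2 \<and> a \<le> (v$2)\<^sup>2 \<and> a \<le> amplitude lam v \<and> amplitude lam v \<le> b"
    using collar_bounds by metis
  \<comment> \<open>a lower bound for the steepness of the squared energy along rays, up to the factor \<open>(lam + 1) ^ (lam + 1)\<close>; it bounds amplitudes by energies with factor \<open>K\<close>\<close>
  define m where "m = a ^ (lam - 1) * a * min 1 a"
  have m: "0 < m" using a by (simp add: m_def)
  define K where "K = (real lam + 1) ^ (lam + 1) * (2 * (\<bar>h\<bar> + \<eta>)) / m"
  define L where "L = max (2 * (real lam * (2 * b) + real lam)) (3 * (2 * b + 1)) * K + 1"
  have K: "0 \<le> K" using m \<eta> by (simp add: K_def)
  show thesis
  proof (rule that[of L])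
    show "0 < L"
      using a K unfolding L_def by (intro add_nonneg_pos mult_nonneg_nonneg) (auto simp: le_max_iff_disj)
    fix u v \<alpha>
    assume u: "u \<in> collar" and v: "v \<in> collar" and au: "has_angle lam u \<alpha>" and av: "has_angle lam v \<alpha>"
    define r \<rho> s k d where defs: "r = amplitude lam u" "\<rho> = amplitude lam v" "s = sin \<alpha>" "k = cos \<alpha>" "d = \<bar>r - \<rho>\<bar>"
    have unit: "s\<^sup>2 + k\<^sup>2 = 1" by (simp add: defs)
    have s1: "s\<^sup>2 \<le> 1" and k1: "\<bar>k\<bar> \<le> 1"
      using unit zero_le_power2[of k] abs_cos_le_one[of \<alpha>] by (linarith, simp add: defs)
    note U = ray_coordinates[OF u au, folded defs] and V = ray_coordinates[OF v av, folded defs]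
    have H: "(real lam + 1) ^ (lam + 1) * (energy lam w)\<^sup>2 = (real lam + 1) * (w$1)\<^sup>2 * ((real lam + 1) * (w$2)\<^sup>2) ^ lam" for w
      by (simp add: energy_def power_mult_distrib power_mult[symmetric] mult_ac)
    have scale: "a \<le> (real lam + 1) * x" if "a \<le> x" for x
    proof -
      have "0 \<le> x" using that a by linarith
      then have "1 * x \<le> (real lam + 1) * x" by (intro mult_right_mono) auto
      then show ?thesis using that by simp
    qed
    have "m * d \<le> \<bar>(real lam + 1) ^ (lam + 1) * (energy lam u)\<^sup>2 - (real lam + 1) ^ (lam + 1) * (energy lam v)\<^sup>2\<bar>"
      unfolding H U V m_def defs(5)
    proof (rule energy_along_ray[OF unit])
      show "a \<le> 2 * c - s\<^sup>2 * r\<^sup>2 - k * r" "a \<le> k * r + real lam * (2 * c - s\<^sup>2 * r\<^sup>2)"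
        unfolding U(1,2)[symmetric] using bounds[OF u] scale by blast+
      show "a \<le> 2 * c - s\<^sup>2 * \<rho>\<^sup>2 - k * \<rho>" "a \<le> k * \<rho> + real lam * (2 * c - s\<^sup>2 * \<rho>\<^sup>2)"
        unfolding V(1,2)[symmetric] using bounds[OF v] scale by blast+
      show "a \<le> r" "a \<le> \<rho>" using bounds[OF u] bounds[OF v] by (simp_all add: defs)
    qed (use lam a in auto)
    also have "\<dots> = (real lam + 1) ^ (lam + 1) * (\<bar>energy lam u + energy lam v\<bar> * \<bar>energy lam u - energy lam v\<bar>)"
      by (simp add: right_diff_distrib[symmetric] abs_mult power2_eq_square square_diff_square_factored)
    also have "\<dots> \<le> (real lam + 1) ^ (lam + 1) * ((2 * (\<bar>h\<bar> + \<eta>)) * \<bar>energy lam u - energy lam v\<bar>)"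
      using collar_abs_energy[OF u] collar_abs_energy[OF v] by (intro mult_left_mono mult_right_mono) auto
    finally have d: "d \<le> K * \<bar>energy lam u - energy lam v\<bar>"
      using m by (simp add: K_def field_simps)
    have rb: "0 \<le> r" "r \<le> b" "0 \<le> \<rho>" "\<rho> \<le> b"
      using bounds[OF u] bounds[OF v] by (auto simp: defs amplitude_nonneg)
    have "0 \<le> d" by (simp add: defs)
    have sq: "\<bar>r\<^sup>2 - \<rho>\<^sup>2\<bar> \<le> 2 * b * d"
    proof -
      have "\<bar>r\<^sup>2 - \<rho>\<^sup>2\<bar> = (r + \<rho>) * d"
        using rb by (simp add: defs power2_eq_square square_diff_square_factored abs_mult)
      also have "\<dots> \<le> 2 * b * d" using rb \<open>0 \<le> d\<close> by (intro mult_right_mono) auto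
      finally show ?thesis .
    qed
    have ssq: "\<bar>s\<^sup>2 * r\<^sup>2 - s\<^sup>2 * \<rho>\<^sup>2\<bar> \<le> 2 * b * d"
      using mult_mono[OF s1 sq] by (simp add: right_diff_distrib[symmetric] abs_mult)
    have kd: "\<bar>k * r - k * \<rho>\<bar> \<le> d"
      using mult_right_mono[OF k1, of d] by (simp add: right_diff_distrib[symmetric] abs_mult defs)
    have "rotation lam u - rotation lam v
        = - (2 * s\<^sup>2 * (real lam * (s\<^sup>2 * r\<^sup>2 - s\<^sup>2 * \<rho>\<^sup>2) + (real lam - 1) * (k * r - k * \<rho>)))"
      unfolding U(3) V(3) by (simp add: algebra_simps)
    then have "\<bar>rotation lam u - rotation lam v\<bar>
        = 2 * s\<^sup>2 * \<bar>real lam * (s\<^sup>2 * r\<^sup>2 - s\<^sup>2 * \<rho>\<^sup>2) + (real lam - 1) * (k * r - k * \<rho>)\<bar>"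
      by (simp only: abs_minus_cancel abs_mult) simp
    also have "\<dots> \<le> 2 * 1 * (real lam * (2 * b * d) + real lam * d)"
    proof (intro mult_mono)
      have "\<bar>real lam * (s\<^sup>2 * r\<^sup>2 - s\<^sup>2 * \<rho>\<^sup>2)\<bar> \<le> real lam * (2 * b * d)"
        using ssq by (simp add: abs_mult mult_left_mono)
      moreover have "\<bar>(real lam - 1) * (k * r - k * \<rho>)\<bar> \<le> real lam * d"
        unfolding abs_mult using lam kd by (intro mult_mono) auto
      ultimately show "\<bar>real lam * (s\<^sup>2 * r\<^sup>2 - s\<^sup>2 * \<rho>\<^sup>2) + (real lam - 1) * (k * r - k * \<rho>)\<bar> \<le> real lam * (2 * b * d) + real lam * d"
        by linarith
    qed (use s1 in auto)
    also have "\<dots> = (2 * (real lam * (2 * b) + real lam)) * d" by (simp add: algebra_simps)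
    finally have rot: "\<bar>rotation lam u - rotation lam v\<bar> \<le> (2 * (real lam * (2 * b) + real lam)) * d" .
    \<comment> \<open>numbers of equal sign are at least as close as the difference of squares suggests\<close>
    have near_square: "(x - y)\<^sup>2 \<le> \<bar>x\<^sup>2 - y\<^sup>2\<bar>" if "0 < x * y" for x y :: real
    proof -
      have "\<bar>x - y\<bar> \<le> \<bar>x + y\<bar>" using that by (auto simp: zero_less_mult_iff)
      then have "\<bar>x - y\<bar> * \<bar>x - y\<bar> \<le> \<bar>x + y\<bar> * \<bar>x - y\<bar>" by (intro mult_right_mono) auto
      then show ?thesis by (simp add: power2_eq_square square_diff_square_factored abs_mult)
    qed
    have y_sign: "0 < u$2 * v$2"
    proof -
      have "0 < (\<sigma> * u$2) * (\<sigma> * v$2)" using u v by (auto simp: collar_def)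
      then have "0 < \<sigma>\<^sup>2 * (u$2 * v$2)" by (simp add: power2_eq_square mult_ac)
      then show ?thesis using \<sigma> by (simp add: zero_less_mult_iff)
    qed
    have x_sign: "0 < u$1 * v$1"
    proof -
      have "0 < (u$1 * v$1) * (u$2 * v$2) ^ lam"
        using collar_energy_same_sign[OF u v] by (simp add: energy_def power_mult_distrib mult_ac)
      then show ?thesis by (rule zero_less_mult_pos2[OF _ zero_less_power[OF y_sign]])
    qed
    have shrink: "\<bar>x\<bar> \<le> t" if "\<bar>(real lam + 1) * x\<bar> \<le> (real lam + 1) * t" for x t
      using that by (simp add: abs_mult)
    have "\<bar>(u$1)\<^sup>2 - (v$1)\<^sup>2\<bar> \<le> (2 * b + 1) * d"
    proof (rule shrink)
      have "\<bar>(real lam + 1) * ((u$1)\<^sup>2 - (v$1)\<^sup>2)\<bar> = \<bar>(s\<^sup>2 * r\<^sup>2 - s\<^sup>2 * \<rho>\<^sup>2) + (k * r - k * \<rho>)\<bar>"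
        unfolding right_diff_distrib[of "real lam + 1"] U V by simp
      also have "\<dots> \<le> (2 * b + 1) * d" using ssq kd by (simp add: distrib_right)
      also have "\<dots> \<le> (real lam + 1) * ((2 * b + 1) * d)"
      proof -
        have "1 * ((2 * b + 1) * d) \<le> (real lam + 1) * ((2 * b + 1) * d)"
          using a \<open>0 \<le> d\<close> by (intro mult_right_mono mult_nonneg_nonneg) auto
        then show ?thesis by simp
      qed
      finally show "\<bar>(real lam + 1) * ((u$1)\<^sup>2 - (v$1)\<^sup>2)\<bar> \<le> (real lam + 1) * ((2 * b + 1) * d)" .
    qed
    then have dx: "(u$1 - v$1)\<^sup>2 \<le> (2 * b + 1) * d" using near_square[OF x_sign] by linarith
    have "\<bar>(u$2)\<^sup>2 - (v$2)\<^sup>2\<bar> \<le> (2 * b + 1) * d"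
    proof (rule shrink)
      have "\<bar>(real lam + 1) * ((u$2)\<^sup>2 - (v$2)\<^sup>2)\<bar> = \<bar>(k * r - k * \<rho>) - real lam * (s\<^sup>2 * r\<^sup>2 - s\<^sup>2 * \<rho>\<^sup>2)\<bar>"
        unfolding right_diff_distrib[of "real lam + 1"] U V by (simp add: algebra_simps)
      also have "\<dots> \<le> d + real lam * (2 * b * d)"
      proof -
        have "\<bar>real lam * (s\<^sup>2 * r\<^sup>2 - s\<^sup>2 * \<rho>\<^sup>2)\<bar> \<le> real lam * (2 * b * d)"
          using ssq by (simp add: abs_mult mult_left_mono)
        then show ?thesis using kd by linarith
      qed
      also have "\<dots> \<le> (real lam + 1) * ((2 * b + 1) * d)"
        using a \<open>0 \<le> d\<close> by (simp add: algebra_simps)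
      finally show "\<bar>(real lam + 1) * ((u$2)\<^sup>2 - (v$2)\<^sup>2)\<bar> \<le> (real lam + 1) * ((2 * b + 1) * d)" .
    qed
    then have dy: "(u$2 - v$2)\<^sup>2 \<le> (2 * b + 1) * d" using near_square[OF y_sign] by linarith
    have "(u$3 - v$3)\<^sup>2 = s\<^sup>2 * (d * d)"
      using au av by (simp add: has_angle_def defs power2_eq_square algebra_simps)
    also have "\<dots> \<le> 1 * ((2 * b) * d)"
      using s1 rb \<open>0 \<le> d\<close> by (intro mult_mono) (auto simp: defs)
    also have "\<dots> \<le> (2 * b + 1) * d" using \<open>0 \<le> d\<close> by (simp add: distrib_right)
    finally have dz: "(u$3 - v$3)\<^sup>2 \<le> (2 * b + 1) * d" .
    have "(norm (u - v))\<^sup>2 = (u$1 - v$1)\<^sup>2 + (u$2 - v$2)\<^sup>2 + (u$3 - v$3)\<^sup>2"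
      by (simp add: norm_vec_def L2_set_def sum_3)
    then have nrm: "(norm (u - v))\<^sup>2 \<le> (3 * (2 * b + 1)) * d" using dx dy dz by (simp add: algebra_simps)
    have "C * d \<le> L * \<bar>energy lam u - energy lam v\<bar>"
      if "C \<le> max (2 * (real lam * (2 * b) + real lam)) (3 * (2 * b + 1))" "0 \<le> C" for C
    proof -
      have "C * d \<le> max (2 * (real lam * (2 * b) + real lam)) (3 * (2 * b + 1)) * (K * \<bar>energy lam u - energy lam v\<bar>)"
        using that d \<open>0 \<le> d\<close> by (intro mult_mono) auto
      also have "\<dots> \<le> L * \<bar>energy lam u - energy lam v\<bar>" by (simp add: L_def algebra_simps)
      finally show ?thesis .
    qed
    from order_trans[OF rot this] order_trans[OF nrm this]
    show "\<bar>rotation lam u - rotation lam v\<bar> \<le> L * \<bar>energy lam u - energy lam v\<bar> \<and>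
       (norm (u - v))\<^sup>2 \<le> L * \<bar>energy lam u - energy lam v\<bar>"
      using a by simp
  qed
qed

end

section \<open>The level curve as a periodic orbit\<close>

context rattleback_level
begin

text \<open>The angular velocity of \<open>(tilt, height)\<close> under the perturbed field.\<close>

definition angular_speed :: "real \<Rightarrow> real^3 \<Rightarrow> real" where
  "angular_speed \<epsilon> v = rotation lam v
     - (real lam + 1) * \<epsilon> * (energy lam v - h) * energy lam v * (v$3 * tilt lam v) / (amplitude lam v)\<^sup>2"

text \<open>A solution on the whole line or on the half line that stays in the collar has a differentiable angle; the field
  determines its velocity.\<close>

lemma angle_lift:
  assumes I: "I = UNIV \<or> I = {0..}" and u: "solution_on (perturbed_rattleback lam \<epsilon> h) S I u"
    and collar: "\<And>t. t \<in> I \<Longrightarrow> u t \<in> collar" and init: "has_angle lam (u 0) \<alpha>0"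
  obtains \<alpha> where "\<alpha> 0 = \<alpha>0" "\<And>t. t \<in> I \<Longrightarrow> has_angle lam (u t) (\<alpha> t)"
    "\<And>t. t \<in> I \<Longrightarrow> (\<alpha> has_real_derivative angular_speed \<epsilon> (u t)) (at t within I)"
proof -
  have lam0: "0 < lam" using lam by simp
  \<comment> \<open>a retraction of the line onto \<open>I\<close>, to extend the angular speed to all times\<close>
  define p where "p t = (if I = UNIV then t else max 0 t)" for t :: real
  have p: "p t \<in> I" "t \<in> I \<Longrightarrow> p t = t" for t using I by (auto simp: p_def)
  have I0: "convex I" "0 \<in> I" using I by auto
  have r0: "0 < amplitude lam (u t)" if "t \<in> I" for t using collar_amplitude_pos[OF collar[OF that]] .
  have "continuous_on I (\<lambda>t. angular_speed \<epsilon> (u t))"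
    unfolding angular_speed_def
    by (intro continuous_intros continuous_on_rotation solution_continuous_on[OF u])
       (use r0 in force)+
  moreover have "continuous_on UNIV p"
    unfolding p_def by (cases "I = UNIV") (auto intro!: continuous_intros)
  ultimately have "continuous_on UNIV (\<lambda>t. angular_speed \<epsilon> (u (p t)))"
    by (rule continuous_on_compose2) (use p in auto)
  then obtain F where F: "\<And>t. (F has_real_derivative angular_speed \<epsilon> (u (p t))) (at t)"
    by (rule antiderivative_on_line) blast
  define \<alpha> where "\<alpha> t = F t - F 0 + \<alpha>0" for t
  have \<alpha>: "(\<alpha> has_real_derivative angular_speed \<epsilon> (u t)) (at t within I)" if "t \<in> I" for t
  proof -
    have "(\<alpha> has_real_derivative angular_speed \<epsilon> (u (p t))) (at t)"
      unfolding \<alpha>_def[abs_def] by (auto intro!: derivative_eq_intros F)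
    then show ?thesis using p(2)[OF that] by (simp add: has_field_derivative_at_within)
  qed
  have "has_angle lam (u t) (\<alpha> t)" if "t \<in> I" for t
    unfolding has_angle_def amplitude_def
  proof (rule polar_angle_transported[OF I0 that, of "\<lambda>t. u t $ 3" _ "\<lambda>t. tilt lam (u t)" _ \<alpha> "\<lambda>t. angular_speed \<epsilon> (u t)"])
    fix t assume t: "t \<in> I"
    show "((\<lambda>t. u t $ 3) has_real_derivative
       tilt lam (u t) + (real lam + 1) * \<epsilon> * (energy lam (u t) - h) * energy lam (u t) * u t $ 3) (at t within I)"
      by (rule height_derivative[OF lam0 u t])
    show "((\<lambda>t. tilt lam (u t)) has_real_derivative
       - 2 * u t $ 3 * stiffness lam (u t)
       + 2 * (real lam + 1) * \<epsilon> * (energy lam (u t) - h) * energy lam (u t) * tilt lam (u t)) (at t within I)"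
      by (rule tilt_derivative[OF lam0 u t])
    show "(\<alpha> has_real_derivative angular_speed \<epsilon> (u t)) (at t within I)" by (rule \<alpha>[OF t])
    have r: "(u t $ 3)\<^sup>2 + (tilt lam (u t))\<^sup>2 = (amplitude lam (u t))\<^sup>2" by (simp add: amplitude_squared)
    show pos: "0 < (u t $ 3)\<^sup>2 + (tilt lam (u t))\<^sup>2" unfolding r using r0[OF t] by simp
    define K where "K = (real lam + 1) * \<epsilon> * (energy lam (u t) - h) * energy lam (u t)"
    have "rotation lam (u t) * (amplitude lam (u t))\<^sup>2 = (tilt lam (u t))\<^sup>2 + 2 * (u t $ 3)\<^sup>2 * stiffness lam (u t)"
      using pos unfolding rotation_def r[symmetric] by simp
    then have "angular_speed \<epsilon> (u t) * ((u t $ 3)\<^sup>2 + (tilt lam (u t))\<^sup>2)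
        = (tilt lam (u t))\<^sup>2 + 2 * (u t $ 3)\<^sup>2 * stiffness lam (u t) - K * (u t $ 3 * tilt lam (u t))"
      using r0[OF t] unfolding r angular_speed_def K_def by (simp add: left_diff_distrib)
    then show "tilt lam (u t) * (tilt lam (u t) + (real lam + 1) * \<epsilon> * (energy lam (u t) - h) * energy lam (u t) * u t $ 3)
      - u t $ 3 * (- 2 * u t $ 3 * stiffness lam (u t)
       + 2 * (real lam + 1) * \<epsilon> * (energy lam (u t) - h) * energy lam (u t) * tilt lam (u t))
      = angular_speed \<epsilon> (u t) * ((u t $ 3)\<^sup>2 + (tilt lam (u t))\<^sup>2)"
      by (simp add: K_def algebra_simps power2_eq_square)
  next
    show "u 0 $ 3 = sqrt ((u 0 $ 3)\<^sup>2 + (tilt lam (u 0))\<^sup>2) * sin (\<alpha> 0)"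
      "tilt lam (u 0) = sqrt ((u 0 $ 3)\<^sup>2 + (tilt lam (u 0))\<^sup>2) * cos (\<alpha> 0)"
      using init by (simp_all add: has_angle_def amplitude_def \<alpha>_def)
  qed
  with \<alpha> show thesis by (intro that[of \<alpha>]) (auto simp: \<alpha>_def)
qed

text \<open>At height \<open>0\<close>, let \<open>y\<close> run from \<open>0\<close> to its value \<open>M\<close> at the maximum of the energy. The modulus of
  the energy then runs from zero to that maximum, and takes the value \<open>\<bar>h\<bar>\<close> on the way.\<close>

lemma cycle_nonempty: "cycle \<noteq> {}"
proof -
  define M where "M = sqrt (2 * c * real lam / (real lam + 1))"
  define f where "f y = y ^ lam * sqrt (2 * c - y\<^sup>2)" for y :: real
  have M: "0 \<le> M" "M\<^sup>2 = 2 * c * real lam / (real lam + 1)" using c by (simp_all add: M_def)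
  have M2: "2 * c - M\<^sup>2 = 2 * c / (real lam + 1)" unfolding M(2) by (simp add: field_simps)
  have "(f M)\<^sup>2 = (M\<^sup>2) ^ lam * (2 * c - M\<^sup>2)"
    using c unfolding f_def M2 power_mult_distrib by (simp add: power_mult[symmetric] mult.commute)
  also have "\<dots> = real lam ^ lam * ((2 * c / (real lam + 1)) ^ lam * (2 * c / (real lam + 1)))"
    unfolding M2 unfolding M(2) by (simp add: power_mult_distrib power_divide)
  also have "\<dots> = real lam ^ lam * (2 / (real lam + 1)) ^ (lam + 1) * c ^ (lam + 1)"
    by (simp add: power_mult_distrib power_divide mult_ac)
  finally have "\<bar>h\<bar>\<^sup>2 < (f M)\<^sup>2"
    using below_crest power_mono[of "\<bar>h\<bar>" "\<bar>h\<bar> + \<eta>" 2] \<eta> by simp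
  moreover have "0 \<le> f M" using M M2 c by (simp add: f_def)
  ultimately have "\<bar>h\<bar> \<le> f M" using power2_less_imp_less by fastforce
  moreover have "f 0 \<le> \<bar>h\<bar>" using lam by (simp add: f_def zero_power)
  moreover have "continuous_on {0..M} f" unfolding f_def by (intro continuous_intros)
  ultimately obtain y where y: "0 \<le> y" "y \<le> M" "f y = \<bar>h\<bar>" using IVT'[of f 0 "\<bar>h\<bar>" M] M by auto
  have "y \<noteq> 0" using y(3) \<eta> lam by (auto simp: f_def zero_power)
  define Y where "Y = sgn \<sigma> * y"
  have "Y\<^sup>2 = y\<^sup>2" using \<sigma> by (simp add: Y_def sgn_if)
  moreover have "\<sigma> * Y = \<bar>\<sigma>\<bar> * y" by (simp add: Y_def sgn_if abs_if)
  then have "0 < \<sigma> * Y" using \<sigma> y(1) \<open>y \<noteq> 0\<close> by simp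
  ultimately have Y: "Y\<^sup>2 = y\<^sup>2" "0 < \<sigma> * Y" .
  have Y0: "Y \<noteq> 0" using Y by auto
  define x where "x = h / Y ^ lam"
  have "y\<^sup>2 \<le> M\<^sup>2" using y by (intro power_mono) auto
  then have y2: "0 \<le> 2 * c - y\<^sup>2" using M2 c by (smt (verit) divide_nonneg_nonneg of_nat_0_le_iff)
  have "x\<^sup>2 = h\<^sup>2 / (Y\<^sup>2) ^ lam"
    by (simp add: x_def power_divide power_mult[symmetric] mult.commute)
  also have "h\<^sup>2 = (f y)\<^sup>2" using y(3) by simp
  also have "(f y)\<^sup>2 = (y\<^sup>2) ^ lam * (2 * c - y\<^sup>2)"
    using y2 by (simp add: f_def power_mult_distrib power_mult[symmetric] mult.commute)
  finally have "x\<^sup>2 = 2 * c - y\<^sup>2" using \<open>y \<noteq> 0\<close> by (simp add: Y)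
  then have "vector [x, Y, 0] \<in> cycle"
    using Y Y0 by (simp add: cycle_def casimir_def energy_def x_def)
  then show ?thesis by blast
qed

lemma cycle_angle_unique:
  assumes "p \<in> cycle" "q \<in> cycle" "has_angle lam p \<alpha>" "has_angle lam q \<alpha>"
  shows "p = q"
proof -
  obtain L where L: "\<And>u v \<alpha>. u \<in> collar \<Longrightarrow> v \<in> collar \<Longrightarrow> has_angle lam u \<alpha> \<Longrightarrow> has_angle lam v \<alpha> \<Longrightarrow>
       (norm (u - v))\<^sup>2 \<le> L * \<bar>energy lam u - energy lam v\<bar>"
    using same_angle_comparison by metis
  have "(norm (p - q))\<^sup>2 \<le> L * \<bar>energy lam p - energy lam q\<bar>"
    using assms cycle_subset_collar by (intro L) auto
  also have "\<dots> = 0" using assms by (simp add: cycle_def)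
  finally show ?thesis by simp
qed

lemma rotation_bounded_below:
  obtains m where "0 < m" "\<And>v. v \<in> collar \<Longrightarrow> m \<le> rotation lam v"
proof -
  obtain a b where a: "0 < a" and bounds:
    "\<And>v. v \<in> collar \<Longrightarrow> a \<le> (v$1)\<^sup>2 \<and> a \<le> (v$2)\<^sup>2 \<and> a \<le> amplitude lam v \<and> amplitude lam v \<le> b"
    using collar_bounds by metis
  have "min 1 a \<le> rotation lam v" if "v \<in> collar" for v
    using bounds[OF that] a collar_amplitude_pos[OF that] by (intro rotation_bound) auto
  then show thesis using that[of "min 1 a"] a by simp
qed

text \<open>A rattleback solution on the level curve turns with angular velocity bounded away from zero, so it
  completes a full turn. Points of the level curve with the same angle coincide, so the solution is
  then back at its start, and by uniqueness it is periodic. For the same reason it passes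
  through every point of the curve.\<close>

lemma cycle_periodic_parametrization:
  "\<exists>\<gamma> T. solution_on (rattleback lam) cycle UNIV \<gamma> \<and> range \<gamma> = cycle \<and>
     0 < T \<and> (\<forall>t. \<gamma> (t + T) = \<gamma> t)"
proof -
  let ?P = "perturbed_rattleback lam 0 h"
  have P: "?P = rattleback lam" by (intro ext perturbed_rattleback_eq_rattleback) simp
  obtain v0 where v0: "v0 \<in> cycle" using cycle_nonempty by blast
  obtain u where u: "solution_on ?P UNIV {0..} u" and u0: "u 0 = v0"
    using perturbed_rattleback_half_line_solution by blast
  have in_collar: "u t \<in> collar" and "energy lam (u t) = h" if "0 \<le> t" for t
    using forward_invariant[OF _ u _ that] u0 v0 cycle_subset_collar by (auto simp: cycle_def)
  then have in_cycle: "u t \<in> cycle" if "0 \<le> t" for t using that by (auto simp: cycle_def collar_def)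
  then have u: "solution_on ?P cycle {0..} u" using u by (simp add: solution_on_def)
  obtain m where m: "0 < m" "\<And>v. v \<in> collar \<Longrightarrow> m \<le> rotation lam v" using rotation_bounded_below by blast
  obtain \<alpha>0 where "has_angle lam (u 0) \<alpha>0" using has_angle_exists by blast
  then obtain \<alpha> where ang: "\<And>t. 0 \<le> t \<Longrightarrow> has_angle lam (u t) (\<alpha> t)"
    and \<alpha>: "\<And>t. 0 \<le> t \<Longrightarrow> (\<alpha> has_real_derivative rotation lam (u t)) (at t within {0..})"
    using angle_lift[OF _ u, of \<alpha>0] in_collar by (auto simp: angular_speed_def)
  have growth: "\<alpha> 0 + m * t \<le> \<alpha> t" if "0 \<le> t" for t
  proof -
    have "m * t - \<alpha> t \<le> m * 0 - \<alpha> 0"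
    proof (rule half_line_nonincreasing[where f = "\<lambda>t. m * t - \<alpha> t" and s = 0])
      show "((\<lambda>t. m * t - \<alpha> t) has_real_derivative m - rotation lam (u t)) (at t within {0..})" if "0 \<le> t" for t
        using \<alpha>[OF that] by (auto intro!: derivative_eq_intros)
    qed (use that m(2) in_collar in auto)
    then show ?thesis by simp
  qed
  have reach: "\<exists>t\<ge>0. \<alpha> t = x" if "\<alpha> 0 \<le> x" for x
  proof -
    define d where "d = (x - \<alpha> 0) / m"
    have d: "0 \<le> d" "m * d = x - \<alpha> 0" using that m by (simp_all add: d_def)
    have "continuous_on {0..d} \<alpha>"
      by (rule continuous_on_subset[OF DERIV_continuous_on[of "{0..}" \<alpha> "\<lambda>t. rotation lam (u t)"]])
         (use \<alpha> in auto)
    then show ?thesis using IVT'[of \<alpha> 0 x d] that growth[OF d(1)] d by auto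
  qed
  obtain T where T: "0 \<le> T" "\<alpha> T = \<alpha> 0 + 2 * pi" using reach[of "\<alpha> 0 + 2 * pi"] by auto
  have "0 < T" using T by (cases "T = 0") auto
  have "has_angle lam (u T) (\<alpha> 0)"
    using ang[OF T(1)] has_angle_add_full_turns[of lam "u T" "\<alpha> 0" 1] T(2) by simp
  then have "u T = u 0" using cycle_angle_unique in_cycle T(1) ang[of 0] by blast
  have per: "u (t + T) = u t" if "0 \<le> t" for t
  proof -
    have "bounded cycle"
      using bounded_subset[OF compact_imp_bounded[OF collar_compact] cycle_subset_collar] .
    then obtain L where "0 < L" and L: "\<And>p q. p \<in> cycle \<Longrightarrow> q \<in> cycle \<Longrightarrow> norm (?P p - ?P q) \<le> L * norm (p - q)"
      using perturbed_rattleback_lipschitz[of cycle lam 0 h] by blast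
    have "u (0 + T) = u 0" using \<open>u T = u 0\<close> by simp
    from lipschitz_field_solutions_agree[OF L solution_on_shift[OF u T(1)] u this that]
    show ?thesis .
  qed
  obtain \<gamma> where \<gamma>: "solution_on ?P cycle UNIV \<gamma>" "\<forall>t. \<gamma> (t + T) = \<gamma> t" "range \<gamma> = u ` {0..}"
    using periodic_extension[OF u \<open>0 < T\<close> per] by blast
  have "u ` {0..} = cycle"
  proof (intro subset_antisym subsetI)
    fix p assume p: "p \<in> cycle"
    obtain b where b: "has_angle lam p b" using has_angle_exists by blast
    define n where "n = \<lceil>(\<alpha> 0 - b) / (2 * pi)\<rceil>"
    have "(\<alpha> 0 - b) / (2 * pi) \<le> of_int n" unfolding n_def by (rule le_of_int_ceiling)
    then have "\<alpha> 0 \<le> b + 2 * pi * of_int n" by (simp add: divide_le_eq mult.commute)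
    then obtain t where t: "0 \<le> t" "\<alpha> t = b + 2 * pi * of_int n" using reach by blast
    then have "has_angle lam (u t) b" using ang[OF t(1)] has_angle_add_full_turns by simp
    then have "u t = p" using cycle_angle_unique in_cycle t(1) p b by blast
    then show "p \<in> u ` {0..}" using t(1) by auto
  qed (use in_cycle in auto)
  then show ?thesis using \<gamma> \<open>0 < T\<close> unfolding P by (intro exI[of _ \<gamma>] exI[of _ T]) simp
qed

end

section \<open>Stability and asymptotic phase\<close>

context rattleback_level
begin

lemma collar_subset_domain: "collar \<subseteq> perturbation_domain lam \<inter> casimir -` {c}"
proof
  fix v assume v: "v \<in> collar"
  have y: "v$2 \<noteq> 0" using v by (auto simp: collar_def)
  have "\<not> (v$3 = 0 \<and> tilt lam v = 0)"
    using collar_amplitude_pos[OF v] by (auto simp: amplitude_def)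
  then have "v \<noteq> vector [M, - M * sqrt (real lam), 0]" "v \<noteq> vector [M, M * sqrt (real lam), 0]" for M
    by (auto simp: tilt_def power_mult_distrib)
  moreover have "v \<noteq> vector [0, 0, M]" for M using y by auto
  ultimately show "v \<in> perturbation_domain lam \<inter> casimir -` {c}"
    using y collar_casimir[OF v] by (auto simp: perturbation_domain_def)
qed

lemma rattleback_nonzero_on_collar:
  assumes "v \<in> collar"
  shows "rattleback lam v \<noteq> 0"
proof
  assume 0: "rattleback lam v = 0"
  have "v$1 \<noteq> 0" using energy_near_h_nonzero assms by (auto simp: collar_def)
  moreover have "real lam * v$1 * v$3 = 0" "tilt lam v = 0"
    using arg_cong[OF 0, of "\<lambda>w. w$1"] arg_cong[OF 0, of "\<lambda>w. w$3"]
    by (simp_all add: rattleback_def Let_def tilt_def)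
  ultimately have "amplitude lam v = 0" using lam by (simp add: amplitude_def)
  then show False using collar_amplitude_pos[OF assms] by simp
qed

lemma cycle_periodic_solution:
  assumes \<gamma>: "solution_on (rattleback lam) cycle UNIV \<gamma>" and T: "0 < T" "\<And>t. \<gamma> (t + T) = \<gamma> t"
  shows "cycle \<subseteq> D \<Longrightarrow> periodic_solution (rattleback lam) D \<gamma>"
    and "cycle \<subseteq> D \<Longrightarrow> periodic_solution (perturbed_rattleback lam \<epsilon> h) D \<gamma>"
proof -
  have moves: "\<exists>t. \<gamma> t \<noteq> \<gamma> 0"
  proof (rule ccontr)
    assume "\<not> ?thesis"
    then have "\<gamma> = (\<lambda>_. \<gamma> 0)" by auto
    then have "(\<gamma> has_vector_derivative 0) (at 0)" by (metis has_vector_derivative_const)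
    moreover have "(\<gamma> has_vector_derivative rattleback lam (\<gamma> 0)) (at 0)" "\<gamma> 0 \<in> cycle"
      using \<gamma> by (auto simp: solution_on_def)
    ultimately show False
      using vector_derivative_unique_at rattleback_nonzero_on_collar cycle_subset_collar by blast
  qed
  have "perturbed_rattleback lam \<epsilon> h v = rattleback lam v" if "v \<in> cycle" for v
    using that by (intro perturbed_rattleback_eq_rattleback) (simp add: cycle_def)
  then show "cycle \<subseteq> D \<Longrightarrow> periodic_solution (rattleback lam) D \<gamma>"
    "cycle \<subseteq> D \<Longrightarrow> periodic_solution (perturbed_rattleback lam \<epsilon> h) D \<gamma>"
    using \<gamma> T moves by (auto simp: periodic_solution_def solution_on_def)
qed

lemma neighbourhood_in_collar:
  assumes "0 < \<delta>" "\<delta> \<le> \<eta>"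
  obtains d where "0 < d"
    "\<And>v. casimir v = c \<Longrightarrow> infdist v cycle < d \<Longrightarrow> v \<in> collar \<and> \<bar>energy lam v - h\<bar> < \<delta>"
proof -
  define U where "U = {v. \<bar>energy lam v - h\<bar> < \<delta>} \<inter> {v. 0 < \<sigma> * v$2}"
  have "open U"
    unfolding U_def by (intro open_Int open_Collect_less continuous_intros)
  moreover have closed: "closed cycle"
  proof -
    have eq: "cycle = collar \<inter> {v. energy lam v = h}"
      using cycle_subset_collar by (auto simp: cycle_def collar_def)
    show ?thesis
      unfolding eq by (intro closed_Int compact_imp_closed[OF collar_compact] closed_Collect_eq continuous_intros)
  qed
  moreover have "cycle \<subseteq> U" using \<open>0 < \<delta>\<close> by (auto simp: U_def cycle_def)
  moreover have "compact cycle"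
    using compact_Int_closed[OF collar_compact closed] cycle_subset_collar by (simp add: Int_absorb1)
  ultimately obtain d where d: "0 < d" "(\<Union>p\<in>cycle. ball p d) \<subseteq> U"
    using compact_subset_open_imp_ball_epsilon_subset by metis
  show thesis
  proof (rule that[OF d(1)])
    fix v assume v: "casimir v = c" "infdist v cycle < d"
    obtain p where "p \<in> cycle" "infdist v cycle = dist v p"
      using infdist_attains_inf[OF closed cycle_nonempty] by blast
    then have "v \<in> U" using v d(2) by (force simp: dist_commute)
    then show "v \<in> collar \<and> \<bar>energy lam v - h\<bar> < \<delta>"
      using v \<open>\<delta> \<le> \<eta>\<close> by (auto simp: U_def collar_def)
  qed
qed

text \<open>The angle of a periodic solution is a diffeomorphism from time to angle; \<open>\<beta>\<close> is its inverse, which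
  turns an angle into a time on the cycle.\<close>

lemma cycle_angle_chart:
  assumes \<gamma>: "solution_on (rattleback lam) cycle UNIV \<gamma>"
  obtains \<beta> where "\<And>x. has_angle lam (\<gamma> (\<beta> x)) x"
    "\<And>x. (\<beta> has_real_derivative inverse (rotation lam (\<gamma> (\<beta> x)))) (at x)"
proof -
  have P: "perturbed_rattleback lam 0 h = rattleback lam"
    by (intro ext perturbed_rattleback_eq_rattleback) simp
  have in_collar: "\<gamma> t \<in> collar" for t
    using \<gamma> cycle_subset_collar by (auto simp: solution_on_def)
  obtain \<alpha>0 where "has_angle lam (\<gamma> 0) \<alpha>0" using has_angle_exists by blast
  then obtain \<alpha> where ang: "\<And>t. has_angle lam (\<gamma> t) (\<alpha> t)"
    and \<alpha>: "\<And>t. (\<alpha> has_real_derivative rotation lam (\<gamma> t)) (at t)"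
    using angle_lift[of UNIV 0 cycle \<gamma> \<alpha>0] in_collar \<gamma> unfolding P by (auto simp: angular_speed_def)
  obtain m where m: "0 < m" "\<And>v. v \<in> collar \<Longrightarrow> m \<le> rotation lam v"
    using rotation_bounded_below by blast
  obtain \<beta> where \<beta>: "\<And>x. \<alpha> (\<beta> x) = x" "\<And>t. \<beta> (\<alpha> t) = t"
    "\<And>x. (\<beta> has_real_derivative inverse (rotation lam (\<gamma> (\<beta> x)))) (at x)"
    using increasing_bijection_inverse[OF \<alpha> m(2)[OF in_collar] m(1)] by metis
  have "has_angle lam (\<gamma> (\<beta> x)) x" for x using ang[of "\<beta> x"] \<beta>(1) by simp
  then show thesis using \<beta>(3) by (rule that)
qed

lemma angular_speed_near_rotation:
  assumes "0 \<le> \<epsilon>" "v \<in> collar"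
  shows "\<bar>angular_speed \<epsilon> v - rotation lam v\<bar> \<le> (real lam + 1) * \<epsilon> * (\<bar>h\<bar> + \<eta>) * \<bar>energy lam v - h\<bar>"
proof -
  have r: "0 < (amplitude lam v)\<^sup>2" using collar_amplitude_pos[OF assms(2)] by simp
  have "2 * \<bar>v$3\<bar> * \<bar>tilt lam v\<bar> \<le> (v$3)\<^sup>2 + (tilt lam v)\<^sup>2"
    using sum_squares_bound[of "\<bar>v$3\<bar>" "\<bar>tilt lam v\<bar>"] by simp
  moreover have "0 \<le> \<bar>v$3\<bar> * \<bar>tilt lam v\<bar>" by simp
  ultimately have "\<bar>v$3 * tilt lam v\<bar> \<le> (amplitude lam v)\<^sup>2"
    unfolding amplitude_squared abs_mult by linarith
  then have q: "\<bar>v$3 * tilt lam v\<bar> / (amplitude lam v)\<^sup>2 \<le> 1" using r by simp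
  have "\<bar>angular_speed \<epsilon> v - rotation lam v\<bar>
      = ((real lam + 1) * \<epsilon> * \<bar>energy lam v\<bar> * \<bar>energy lam v - h\<bar>) * (\<bar>v$3 * tilt lam v\<bar> / (amplitude lam v)\<^sup>2)"
    using assms(1) by (simp add: angular_speed_def abs_mult mult_ac)
  also have "\<dots> \<le> ((real lam + 1) * \<epsilon> * (\<bar>h\<bar> + \<eta>) * \<bar>energy lam v - h\<bar>) * 1"
    using assms(1) collar_abs_energy[OF assms(2)] q
    by (intro mult_mono) (auto intro!: mult_right_mono mult_left_mono)
  finally show ?thesis by simp
qed

lemma cycle_solution_lipschitz:
  assumes \<gamma>: "solution_on (rattleback lam) cycle UNIV \<gamma>"
  obtains B where "\<And>s t. norm (\<gamma> s - \<gamma> t) \<le> B * \<bar>s - t\<bar>"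
proof -
  have P: "perturbed_rattleback lam 0 h = rattleback lam"
    by (intro ext perturbed_rattleback_eq_rattleback) simp
  have bdd: "bounded cycle"
    using bounded_subset[OF compact_imp_bounded[OF collar_compact] cycle_subset_collar] .
  then obtain L where L: "0 < L" "\<And>p q. p \<in> cycle \<Longrightarrow> q \<in> cycle \<Longrightarrow>
      norm (rattleback lam p - rattleback lam q) \<le> L * norm (p - q)"
    using perturbed_rattleback_lipschitz[of cycle lam 0 h] unfolding P by blast
  have "L-lipschitz_on cycle (rattleback lam)"
    using L by (intro lipschitz_onI) (auto simp: dist_norm)
  then have "bounded (rattleback lam ` cycle)"
    using bdd by (intro bounded_uniformly_continuous_image lipschitz_on_uniformly_continuous)
  then obtain B where B: "\<And>p. p \<in> cycle \<Longrightarrow> norm (rattleback lam p) \<le> B"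
    unfolding bounded_iff by auto
  have "norm (\<gamma> s - \<gamma> t) \<le> B * norm (s - t)" for s t
  proof (rule differentiable_bound[of UNIV \<gamma> "\<lambda>t h. h *\<^sub>R rattleback lam (\<gamma> t)"])
    show "(\<gamma> has_derivative (\<lambda>h. h *\<^sub>R rattleback lam (\<gamma> t))) (at t within UNIV)" for t
      using \<gamma> by (simp add: solution_on_def has_vector_derivative_def)
    show "onorm (\<lambda>h. h *\<^sub>R rattleback lam (\<gamma> t)) \<le> B" for t
    proof (rule onorm_le)
      fix h :: real
      have "norm (rattleback lam (\<gamma> t)) \<le> B" using B \<gamma> by (simp add: solution_on_def)
      from mult_right_mono[OF this norm_ge_zero[of h]]
      show "norm (h *\<^sub>R rattleback lam (\<gamma> t)) \<le> B * norm h" by (simp add: mult.commute)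
    qed
  qed auto
  then show thesis by (intro that) simp
qed

text \<open>The solution \<open>u\<close> is compared at each time with the point of the cycle on the same ray, which is
  \<open>\<gamma> (\<psi> t)\<close> for a differentiable function \<open>\<psi>\<close>. The velocity of \<open>\<psi>\<close> is the quotient of the angular velocities at
  the two points, so it differs from \<open>1\<close> by at most a multiple of the energy gap. The gap decays
  exponentially, hence \<open>\<psi> t - t\<close> converges, and its limit is the asymptotic phase.\<close>

lemma asymptotic_phase:
  assumes "0 < \<epsilon>" and \<gamma>: "solution_on (rattleback lam) cycle UNIV \<gamma>"
    and u: "solution_on (perturbed_rattleback lam \<epsilon> h) S {0..} u" and u0: "u 0 \<in> collar"
  shows "\<exists>\<theta>. ((\<lambda>t. norm (u t - \<gamma> (t + \<theta>))) \<longlongrightarrow> 0) at_top"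
proof -
  obtain k where k: "0 < k" and decay: "\<And>t. 0 \<le> t \<Longrightarrow>
      \<bar>energy lam (u t) - h\<bar> \<le> \<bar>energy lam (u 0) - h\<bar> * exp (- k * t)"
    using energy_gap_decays[OF \<open>0 < \<epsilon>\<close>] u u0 by metis
  define g where "g t = energy lam (u t) - h" for t
  have u_in: "u t \<in> collar" if "0 \<le> t" for t
    using forward_invariant(1)[OF _ u u0 that] \<open>0 < \<epsilon>\<close> by simp
  have \<gamma>_in: "\<gamma> t \<in> collar" and \<gamma>_energy: "energy lam (\<gamma> t) = h" for t
    using \<gamma> cycle_subset_collar by (auto simp: solution_on_def cycle_def)
  obtain \<beta> where \<beta>_angle: "\<And>x. has_angle lam (\<gamma> (\<beta> x)) x"
    and \<beta>: "\<And>x. (\<beta> has_real_derivative inverse (rotation lam (\<gamma> (\<beta> x)))) (at x)"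
    using cycle_angle_chart[OF \<gamma>] by metis
  obtain \<alpha>0 where "has_angle lam (u 0) \<alpha>0" using has_angle_exists by blast
  then obtain \<alpha> where ang: "\<And>t. t \<in> {0..} \<Longrightarrow> has_angle lam (u t) (\<alpha> t)"
    and \<alpha>: "\<And>t. t \<in> {0..} \<Longrightarrow> (\<alpha> has_real_derivative angular_speed \<epsilon> (u t)) (at t within {0..})"
    using angle_lift[OF _ u, of \<alpha>0] u_in by auto
  obtain L where L: "0 < L" "\<And>u v \<alpha>. u \<in> collar \<Longrightarrow> v \<in> collar \<Longrightarrow> has_angle lam u \<alpha> \<Longrightarrow> has_angle lam v \<alpha> \<Longrightarrow>
       \<bar>rotation lam u - rotation lam v\<bar> \<le> L * \<bar>energy lam u - energy lam v\<bar> \<and>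
       (norm (u - v))\<^sup>2 \<le> L * \<bar>energy lam u - energy lam v\<bar>"
    using same_angle_comparison by metis
  obtain m where m: "0 < m" "\<And>v. v \<in> collar \<Longrightarrow> m \<le> rotation lam v"
    using rotation_bounded_below by metis
  define \<psi> where "\<psi> t = \<beta> (\<alpha> t)" for t
  have compare: "\<bar>rotation lam (u t) - rotation lam (\<gamma> (\<psi> t))\<bar> \<le> L * \<bar>g t\<bar>"
    "(norm (u t - \<gamma> (\<psi> t)))\<^sup>2 \<le> L * \<bar>g t\<bar>" if "0 \<le> t" for t
    using L(2)[OF u_in[OF that] \<gamma>_in ang \<beta>_angle] that by (simp_all add: \<psi>_def g_def \<gamma>_energy)
  define K where "K = (L + (real lam + 1) * \<epsilon> * (\<bar>h\<bar> + \<eta>)) / m"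
  have K: "0 \<le> K" using L m \<open>0 < \<epsilon>\<close> \<eta> by (simp add: K_def)
  define f' where "f' t = angular_speed \<epsilon> (u t) * inverse (rotation lam (\<gamma> (\<psi> t))) - 1" for t
  have "\<exists>\<theta>. ((\<lambda>t. \<psi> t - t) \<longlongrightarrow> \<theta>) at_top"
  proof (rule half_line_limit_of_summable_speed[OF _ _ k])
    fix t :: real assume t: "0 \<le> t"
    have "(\<psi> has_real_derivative inverse (rotation lam (\<gamma> (\<psi> t))) * angular_speed \<epsilon> (u t)) (at t within {0..})"
      unfolding \<psi>_def[abs_def] by (rule DERIV_chain2[OF \<beta> \<alpha>]) (use t in simp)
    from DERIV_diff[OF this DERIV_ident]
    show "((\<lambda>t. \<psi> t - t) has_real_derivative f' t) (at t within {0..})"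
      by (simp only: f'_def mult.commute)
    have rot: "m \<le> rotation lam (\<gamma> (\<psi> t))" using m(2) \<gamma>_in by simp
    have "f' t = (angular_speed \<epsilon> (u t) - rotation lam (\<gamma> (\<psi> t))) / rotation lam (\<gamma> (\<psi> t))"
      using rot m(1) by (simp add: f'_def field_simps)
    then have "\<bar>f' t\<bar> = \<bar>angular_speed \<epsilon> (u t) - rotation lam (\<gamma> (\<psi> t))\<bar> / rotation lam (\<gamma> (\<psi> t))"
      using rot m(1) by (simp add: abs_divide)
    also have "\<dots> \<le> \<bar>angular_speed \<epsilon> (u t) - rotation lam (\<gamma> (\<psi> t))\<bar> / m"
      using rot m(1) by (intro divide_left_mono) auto
    also have "\<dots> \<le> (((real lam + 1) * \<epsilon> * (\<bar>h\<bar> + \<eta>)) * \<bar>g t\<bar> + L * \<bar>g t\<bar>) / m"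
      using angular_speed_near_rotation[OF _ u_in[OF t], of \<epsilon>] \<open>0 < \<epsilon>\<close> compare(1)[OF t] m(1)
      by (intro divide_right_mono) (auto simp: g_def)
    also have "\<dots> = K * \<bar>g t\<bar>" by (simp add: K_def algebra_simps add_divide_distrib)
    also have "\<dots> \<le> K * (\<bar>g 0\<bar> * exp (- k * t))"
      using decay[OF t] K by (intro mult_left_mono) (auto simp: g_def)
    finally show "\<bar>f' t\<bar> \<le> (K * \<bar>g 0\<bar>) * exp (- k * t)" by (simp add: mult.assoc)
  qed
  then obtain \<theta> where \<theta>: "((\<lambda>t. \<psi> t - t) \<longlongrightarrow> \<theta>) at_top" by blast
  obtain B where B: "\<And>s t. norm (\<gamma> s - \<gamma> t) \<le> B * \<bar>s - t\<bar>"
    using cycle_solution_lipschitz[OF \<gamma>] by metis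
  have gap: "(g \<longlongrightarrow> 0) at_top"
  proof (rule Lim_null_comparison)
    have "filterlim (\<lambda>t. - k * t) at_bot at_top"
      using k by (intro filterlim_tendsto_neg_mult_at_bot[OF tendsto_const]) (auto intro: filterlim_ident)
    then have "((\<lambda>t. \<bar>g 0\<bar> * exp (- k * t)) \<longlongrightarrow> \<bar>g 0\<bar> * 0) at_top"
      by (intro tendsto_intros filterlim_compose[OF exp_at_bot])
    then show "((\<lambda>t. \<bar>g 0\<bar> * exp (- k * t)) \<longlongrightarrow> 0) at_top" by simp
    show "\<forall>\<^sub>F t in at_top. norm (g t) \<le> \<bar>g 0\<bar> * exp (- k * t)"
      using decay by (auto intro!: eventually_at_top_linorderI[of 0] simp: g_def)
  qed
  have "((\<lambda>t. norm (u t - \<gamma> (t + \<theta>))) \<longlongrightarrow> 0) at_top"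
  proof (rule Lim_null_comparison)
    have "((\<lambda>t. sqrt (L * \<bar>g t\<bar>) + B * \<bar>\<psi> t - t - \<theta>\<bar>) \<longlongrightarrow> sqrt (L * \<bar>0\<bar>) + B * \<bar>\<theta> - \<theta>\<bar>) at_top"
      by (intro tendsto_intros gap \<theta>)
    then show "((\<lambda>t. sqrt (L * \<bar>g t\<bar>) + B * \<bar>\<psi> t - t - \<theta>\<bar>) \<longlongrightarrow> 0) at_top" by simp
    have "norm (u t - \<gamma> (t + \<theta>)) \<le> sqrt (L * \<bar>g t\<bar>) + B * \<bar>\<psi> t - t - \<theta>\<bar>" if "0 \<le> t" for t
    proof -
      have "norm (u t - \<gamma> (t + \<theta>)) \<le> norm (u t - \<gamma> (\<psi> t)) + norm (\<gamma> (\<psi> t) - \<gamma> (t + \<theta>))"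
        using norm_triangle_ineq[of "u t - \<gamma> (\<psi> t)" "\<gamma> (\<psi> t) - \<gamma> (t + \<theta>)"] by simp
      moreover have "norm (u t - \<gamma> (\<psi> t)) \<le> sqrt (L * \<bar>g t\<bar>)"
        using compare(2)[OF that] by (rule real_le_rsqrt)
      moreover have "norm (\<gamma> (\<psi> t) - \<gamma> (t + \<theta>)) \<le> B * \<bar>\<psi> t - t - \<theta>\<bar>"
        using B[of "\<psi> t" "t + \<theta>"] by (simp add: diff_diff_eq)
      ultimately show ?thesis by linarith
    qed
    then show "\<forall>\<^sub>F t in at_top. norm (norm (u t - \<gamma> (t + \<theta>))) \<le> sqrt (L * \<bar>g t\<bar>) + B * \<bar>\<psi> t - t - \<theta>\<bar>"
      by (auto intro!: eventually_at_top_linorderI[of 0])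
  qed
  then show ?thesis ..
qed

text \<open>The cycle meets the ray through any point of the collar.\<close>

lemma infdist_cycle_bound:
  obtains L where "0 < L" "\<And>v. v \<in> collar \<Longrightarrow> (infdist v cycle)\<^sup>2 \<le> L * \<bar>energy lam v - h\<bar>"
proof -
  obtain L where L: "0 < L" "\<And>u v \<alpha>. u \<in> collar \<Longrightarrow> v \<in> collar \<Longrightarrow> has_angle lam u \<alpha> \<Longrightarrow> has_angle lam v \<alpha> \<Longrightarrow>
       \<bar>rotation lam u - rotation lam v\<bar> \<le> L * \<bar>energy lam u - energy lam v\<bar> \<and>
       (norm (u - v))\<^sup>2 \<le> L * \<bar>energy lam u - energy lam v\<bar>"
    using same_angle_comparison by metis
  obtain \<gamma> T where \<gamma>: "solution_on (rattleback lam) cycle UNIV \<gamma>" and "range \<gamma> = cycle" "0 < T" "\<And>t. \<gamma> (t + T) = \<gamma> t"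
    using cycle_periodic_parametrization by blast
  obtain \<beta> where \<beta>: "\<And>x. has_angle lam (\<gamma> (\<beta> x)) x"
    "\<And>x. (\<beta> has_real_derivative inverse (rotation lam (\<gamma> (\<beta> x)))) (at x)"
    using cycle_angle_chart[OF \<gamma>] by metis
  have "(infdist v cycle)\<^sup>2 \<le> L * \<bar>energy lam v - h\<bar>" if v: "v \<in> collar" for v
  proof -
    obtain a where a: "has_angle lam v a" using has_angle_exists by blast
    define p where "p = \<gamma> (\<beta> a)"
    have p: "p \<in> cycle" "has_angle lam p a" using \<gamma> \<beta> by (auto simp: p_def solution_on_def)
    have "infdist v cycle \<le> norm (v - p)" using infdist_le[OF p(1)] by (simp add: dist_norm)
    then have "(infdist v cycle)\<^sup>2 \<le> (norm (v - p))\<^sup>2" by (intro power_mono infdist_nonneg)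
    also have "\<dots> \<le> L * \<bar>energy lam v - energy lam p\<bar>"
      using L(2)[OF v _ a p(2)] p(1) cycle_subset_collar by auto
    finally show ?thesis using p(1) by (simp add: cycle_def)
  qed
  with L(1) show thesis by (rule that)
qed

text \<open>The energy gap is a Lyapunov function: it never grows, it is small near the cycle, and it
  controls the distance to the cycle.\<close>

lemma cycle_orbitally_stable:
  assumes "0 < \<epsilon>"
  shows "orbitally_stable (perturbed_rattleback lam \<epsilon> h) (perturbation_domain lam \<inter> casimir -` {c}) cycle"
    (is "orbitally_stable ?P ?S cycle")
  unfolding orbitally_stable_def
proof (intro conjI allI impI)
  obtain d where d: "0 < d" "\<And>v. casimir v = c \<Longrightarrow> infdist v cycle < d \<Longrightarrow> v \<in> collar \<and> \<bar>energy lam v - h\<bar> < \<eta>"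
    using neighbourhood_in_collar[of \<eta>] \<eta> by auto
  show "\<exists>\<delta>>0. \<forall>a\<in>?S. infdist a cycle < \<delta> \<longrightarrow> (\<exists>u. solution_on ?P ?S {0..} u \<and> u 0 = a)"
  proof (intro exI[of _ d] conjI ballI impI)
    fix a assume "a \<in> ?S" "infdist a cycle < d"
    then have a: "a \<in> collar" using d(2) by auto
    obtain u where u: "solution_on ?P UNIV {0..} u" "u 0 = a"
      using perturbed_rattleback_half_line_solution by blast
    have "u t \<in> ?S" if "0 \<le> t" for t
      using forward_invariant(1)[OF _ u(1) _ that] u(2) a \<open>0 < \<epsilon>\<close> collar_subset_domain by auto
    then have "solution_on ?P ?S {0..} u" using u(1) by (simp add: solution_on_def)
    then show "\<exists>u. solution_on ?P ?S {0..} u \<and> u 0 = a" using u(2) by blast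
  qed (rule d(1))
next
  fix e :: real assume "0 < e"
  obtain L where L: "0 < L" "\<And>v. v \<in> collar \<Longrightarrow> (infdist v cycle)\<^sup>2 \<le> L * \<bar>energy lam v - h\<bar>"
    using infdist_cycle_bound by metis
  define \<delta> where "\<delta> = min \<eta> (e\<^sup>2 / L)"
  have \<delta>: "0 < \<delta>" "\<delta> \<le> \<eta>" "L * \<delta> \<le> e\<^sup>2"
    using \<eta> L(1) \<open>0 < e\<close> by (auto simp: \<delta>_def min_def field_simps)
  obtain d where d: "0 < d" "\<And>v. casimir v = c \<Longrightarrow> infdist v cycle < d \<Longrightarrow> v \<in> collar \<and> \<bar>energy lam v - h\<bar> < \<delta>"
    using neighbourhood_in_collar[OF \<delta>(1,2)] by metis
  show "\<exists>\<delta>>0. \<forall>u. solution_on ?P ?S {0..} u \<and> infdist (u 0) cycle < \<delta> \<longrightarrow> (\<forall>t\<ge>0. infdist (u t) cycle < e)"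
  proof (intro exI[of _ d] conjI allI impI)
    fix u and t :: real
    assume u: "solution_on ?P ?S {0..} u \<and> infdist (u 0) cycle < d" and "0 \<le> t"
    then have "casimir (u 0) = c" by (auto simp: solution_on_def)
    then have u0: "u 0 \<in> collar" "\<bar>energy lam (u 0) - h\<bar> < \<delta>" using d(2) u by auto
    have ut: "u t \<in> collar" "\<bar>energy lam (u t) - h\<bar> < \<delta>"
      using forward_invariant[OF _ conjunct1[OF u] u0(1) \<open>0 \<le> t\<close>] \<open>0 < \<epsilon>\<close> u0(2) by auto
    have "(infdist (u t) cycle)\<^sup>2 \<le> L * \<bar>energy lam (u t) - h\<bar>" using L(2) ut by blast
    also have "\<dots> < L * \<delta>" using ut L(1) by simp
    also have "\<dots> \<le> e\<^sup>2" by (rule \<delta>(3))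
    finally show "infdist (u t) cycle < e" using \<open>0 < e\<close> by (simp add: power2_less_imp_less)
  qed (rule d(1))
qed

lemma cycle_stabilized:
  assumes "0 < \<epsilon>"
  shows "asymptotically_stabilizes_with_phase (rattleback lam) (perturbed_rattleback lam \<epsilon> h)
    (perturbation_domain lam) (casimir -` {c}) cycle"
proof -
  let ?P = "perturbed_rattleback lam \<epsilon> h" and ?S = "perturbation_domain lam \<inter> casimir -` {c}"
  obtain \<gamma> T where \<gamma>: "solution_on (rattleback lam) cycle UNIV \<gamma>" and range: "range \<gamma> = cycle"
    and T: "0 < T" "\<And>t. \<gamma> (t + T) = \<gamma> t"
    using cycle_periodic_parametrization by blast
  have sub: "cycle \<subseteq> ?S" using cycle_subset_collar collar_subset_domain by blast
  obtain d where d: "0 < d" "\<And>v. casimir v = c \<Longrightarrow> infdist v cycle < d \<Longrightarrow> v \<in> collar \<and> \<bar>energy lam v - h\<bar> < \<eta>"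
    using neighbourhood_in_collar[of \<eta>] \<eta> by auto
  have attract: "((\<lambda>t. infdist (u t) cycle) \<longlongrightarrow> 0) at_top \<and>
      (\<exists>\<theta>. ((\<lambda>t. norm (u t - \<gamma> (t + \<theta>))) \<longlongrightarrow> 0) at_top)"
    if u: "solution_on ?P ?S {0..} u \<and> infdist (u 0) cycle < d" for u
  proof -
    have "casimir (u 0) = c" using u by (auto simp: solution_on_def)
    then have "u 0 \<in> collar" using d(2) u by auto
    then obtain \<theta> where \<theta>: "((\<lambda>t. norm (u t - \<gamma> (t + \<theta>))) \<longlongrightarrow> 0) at_top"
      using asymptotic_phase[OF assms \<gamma> conjunct1[OF u]] by blast
    have "infdist (u t) cycle \<le> norm (u t - \<gamma> (t + \<theta>))" for t
      using infdist_le[of "\<gamma> (t + \<theta>)" cycle "u t"] range by (auto simp: dist_norm)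
    then have "((\<lambda>t. infdist (u t) cycle) \<longlongrightarrow> 0) at_top"
      by (intro Lim_null_comparison[OF _ \<theta>]) (simp add: infdist_nonneg)
    then show ?thesis using \<theta> by blast
  qed
  have "orbitally_asymptotically_stable_with_phase ?P ?S cycle"
    unfolding orbitally_asymptotically_stable_with_phase_def
    using cycle_periodic_solution(2)[OF \<gamma> T sub] range cycle_orbitally_stable[OF assms] d(1) attract
    by blast
  moreover have "periodic_orbit (rattleback lam) UNIV cycle"
    unfolding periodic_orbit_def using cycle_periodic_solution(1)[OF \<gamma> T] range by blast
  moreover have "periodic_orbit ?P (perturbation_domain lam) cycle"
    unfolding periodic_orbit_def using cycle_periodic_solution(2)[OF \<gamma> T] sub range by blast
  ultimately show ?thesis unfolding asymptotically_stabilizes_with_phase_def by blast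
qed

end

theorem theorem9p2:
  fixes lam :: nat and \<epsilon> h c :: real
  assumes "lam > 1"
    and "\<epsilon> > 0"
    and "(h, c) \<in> Sigma_p_minus lam \<union> Sigma_p_plus lam"
  shows "\<exists>\<Gamma>1 \<Gamma>2.
    periodic_orbit (rattleback lam) UNIV \<Gamma>1 \<and>
    periodic_orbit (rattleback lam) UNIV \<Gamma>2 \<and>
    \<Gamma>1 \<inter> \<Gamma>2 = {} \<and>
    \<Gamma>1 \<union> \<Gamma>2 = energy_casimir lam -` {(h, c)} \<and>
    (\<forall>\<Gamma>\<in>{\<Gamma>1, \<Gamma>2}. asymptotically_stabilizes_with_phase
       (rattleback lam) (perturbed_rattleback lam \<epsilon> h)
       (perturbation_domain lam) (casimir -` {c}) \<Gamma>)"
proof -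
  define top where "top = real lam ^ lam * (2 / (real lam + 1)) ^ (lam + 1) * c ^ (lam + 1)"
  have h: "h\<^sup>2 < top" "h \<noteq> 0" and c: "0 < c"
    using assms(3) by (auto simp: Sigma_p_minus_def Sigma_p_plus_def top_def)
  have "\<bar>h\<bar> < sqrt top" using h(1) by (intro real_less_rsqrt) simp
  \<comment> \<open>the energy band must exclude \<open>0\<close> and the extreme values \<open>sqrt top\<close> and \<open>- sqrt top\<close>\<close>
  define \<eta> where "\<eta> = min (\<bar>h\<bar> / 2) ((sqrt top - \<bar>h\<bar>) / 2)"
  have \<eta>: "0 < \<eta>" "\<eta> < \<bar>h\<bar>" "\<bar>h\<bar> + \<eta> < sqrt top"
    using h(2) \<open>\<bar>h\<bar> < sqrt top\<close> by (auto simp: \<eta>_def min_def field_simps)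
  have "0 \<le> top" using h(1) by (smt (verit) zero_le_power2)
  have "(\<bar>h\<bar> + \<eta>)\<^sup>2 < (sqrt top)\<^sup>2" using \<eta> by (intro power_strict_mono) auto
  then have crest: "(\<bar>h\<bar> + \<eta>)\<^sup>2 < top" using \<open>0 \<le> top\<close> by simp
  interpret pos: rattleback_level lam c h \<eta> 1
    by unfold_locales (use assms(1) c \<eta> crest in \<open>auto simp: top_def\<close>)
  interpret neg: rattleback_level lam c h \<eta> "-1"
    by unfold_locales (use assms(1) c \<eta> crest in \<open>auto simp: top_def\<close>)
  have "pos.cycle \<inter> neg.cycle = {}" by (auto simp: pos.cycle_def neg.cycle_def)
  moreover have "pos.cycle \<union> neg.cycle = energy_casimir lam -` {(h, c)}"
  proof -
    have "v$2 \<noteq> 0" if "energy lam v = h" for v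
      using that h(2) assms(1) by (auto simp: energy_def zero_power)
    then show ?thesis
      unfolding pos.cycle_def neg.cycle_def energy_casimir_def energy_def[symmetric] by force
  qed
  moreover have stable: "\<forall>\<Gamma>\<in>{pos.cycle, neg.cycle}. asymptotically_stabilizes_with_phase
      (rattleback lam) (perturbed_rattleback lam \<epsilon> h) (perturbation_domain lam) (casimir -` {c}) \<Gamma>"
    using pos.cycle_stabilized[OF assms(2)] neg.cycle_stabilized[OF assms(2)] by simp
  moreover have "\<forall>\<Gamma>\<in>{pos.cycle, neg.cycle}. periodic_orbit (rattleback lam) UNIV \<Gamma>"
    using stable unfolding asymptotically_stabilizes_with_phase_def by simp
  ultimately show ?thesis
    by (intro exI[of _ pos.cycle] exI[of _ neg.cycle]) simp
qed

end
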